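(* There is an absolute constant $c>0$ such that for every integer $d\ge 2$ there exist an integer $k_0=k_0(d)$ and a function $\lambda\mapsto C_\lambda\in(0,\infty)$ on $(-2\sqrt d,2\sqrt d)$ (which may depend on $d$), satisfying $$\inf_{\lambda\in[-2\sqrt d+\delta,\,2\sqrt d-\delta]}C_\lambda>0\quad\text{for every sufficiently small }\delta>0,$$ for which the following holds. For an integer $k\ge k_0$ and $\varepsilon\in(0,1)$, let $\Lambda(k,\varepsilon)$ be the set of all $\lambda\in(-2\sqrt d,2\sqrt d)$ for which there is a finite $(d+1)$-regular graph $G=(V,E)$ with adjacency matrix $A_G$ such that: 1. $A_G$ has an eigenvector $v\in\mathbb{R}^V$ with $\sum_{x\in V}v_x^2=1$ and eigenvalue $\lambda$, and there is a set $S\subseteq V$ with $|S|=k$ and $\sum_{x\in S}v_x^2\ge C_\lambda\,\varepsilon$; 2. $G$ has girth at least $c\,\dfrac{\log_d(k)}{\varepsilon}$. Then: (a) $\Lambda(k,\varepsilon)\neq\emptyset$ for every integer $k\ge k_0$ and every $\varepsilon\in(0,1)$; (b) for every fixed $\varepsilon\in(0,1)$, the set $\bigcup_{k\ge k_0}\Lambda(k,\varepsilon)$ is dense in $(-2\sqrt d,2\sqrt d)$; (c) for every fixed integer $k\ge k_0$, the set $\bigcup_{\varepsilon\in(0,1)}\Lambda(k,\varepsilon)$ is dense in $(-2\sqrt d,2\sqrt d)$.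
   Context: The girth of a graph is the length of its shortest cycle. *)

theory Defs
  imports
    "HOL-Analysis.Elementary_Topology"
    "HOL-Library.Extended_Real"
    "Graph_Theory.Pair_Digraph"
    "Jordan_Normal_Form.Char_Poly"
begin

text \<open>
  A finite simple graph is a symmetric loop-free digraph (locale \<open>pair_graph\<close>), each edge
  contributing its two orientations; hence the degree of a vertex is its out-degree.
\<close>

definition regular_graph :: "'a pair_pre_digraph \<Rightarrow> nat \<Rightarrow> bool" where
  "regular_graph G r \<longleftrightarrow>
     pair_graph G \<and> (\<forall>x\<in>pverts G. out_degree (with_proj G) x = r)"

text \<open>
  The library's \<open>cycle\<close> is the notion for digraphs, which also admits the closed walks
  \<open>a, b, a\<close> along a single edge. In a simple graph the bound \<open>3 \<le> length p\<close> excludes exactly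
  these. The girth of a forest is \<open>\<infinity>\<close>.
\<close>

definition girth :: "'a pair_pre_digraph \<Rightarrow> enat" where
  "girth G = (INF p\<in>{p. pre_digraph.cycle (with_proj G) p \<and> 3 \<le> length p}. enat (length p))"

text \<open>Only meaningful for graphs with vertex set \<open>{0..<n}\<close>.\<close>

definition adjacency_matrix :: "nat pair_pre_digraph \<Rightarrow> real mat" where
  "adjacency_matrix G =
     mat (card (pverts G)) (card (pverts G)) (\<lambda>(x, y). if (x, y) \<in> parcs G then 1 else 0)"

text \<open>
  The set \<open>\<Lambda>(k, \<epsilon>)\<close> for given \<open>d\<close>, \<open>c\<close> and \<open>\<lambda> \<mapsto> C\<^sub>\<lambda>\<close>. Up to relabelling, every finite graph has
  vertex set \<open>{0..<n}\<close>.
\<close>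

definition localized_eigenvalues ::
    "nat \<Rightarrow> real \<Rightarrow> (real \<Rightarrow> real) \<Rightarrow> nat \<Rightarrow> real \<Rightarrow> real set" where
  "localized_eigenvalues d c C k \<epsilon> =
     {lam \<in> {- 2 * sqrt (real d) <..< 2 * sqrt (real d)}.
        \<exists>n (G :: nat pair_pre_digraph).
          pverts G = {0..<n} \<and> regular_graph G (d + 1) \<and>
          (\<exists>v. eigenvector (adjacency_matrix G) v lam \<and> (\<Sum>x\<in>pverts G. (v $ x)\<^sup>2) = 1 \<and>
             (\<exists>S\<subseteq>pverts G. card S = k \<and> (\<Sum>x\<in>S. (v $ x)\<^sup>2) \<ge> C lam * \<epsilon>)) \<and>
          ereal_of_enat (girth G) \<ge> ereal (c * (log (real d) (real k) / \<epsilon>))}"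

end

theory Submission
  imports Defs "HOL-Analysis.Elementary_Metric_Spaces"
begin

text \<open>
  Take two \<open>d\<close>-ary trees of depth \<open>r\<close>, join their roots by an edge and join their leaves by a
  \<open>d\<close>-regular bipartite graph. A function that is radial on one tree and its negative on the other
  is an eigenvector as soon as it solves the radial recurrence with the boundary conditions
  \<open>f(-1) = -f(0)\<close> and \<open>f(r+1) = -f(r)\<close>, whatever the bipartite graph is; these hold for the
  eigenvalues \<open>2\<surd>d cos(\<pi>j/(r+1))\<close>. Every level carries about the same mass, so the first
  \<open>log\<^sub>d k\<close> levels, about \<open>k\<close> vertices, carry a fraction of order \<open>(log\<^sub>d k)/r\<close>, which is
  \<open>\<epsilon>\<close> for \<open>r = (log\<^sub>d k)/\<epsilon>\<close>. The bipartite graph is chosen by the switching argument of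
  Erdos and Sachs, which makes the girth linear in \<open>r\<close>.
\<close>

subsection \<open>Switching away short cycles\<close>

text \<open>Antisymmetry is what closes the recurrence at both ends. A root has one neighbour in the
  other tree and a leaf has d of them; the values there are -f(0) and -f(r), which is what the
  recurrence asks of the fictitious levels -1 and r+1. Up to a constant, f(i) is d^(-i/2) times a
  solution of the recurrence of sin(i\<theta>), and the square of this factor cancels the d^i
  vertices of a level. Hence the mass per level is governed by a bounded oscillation, whose lower
  bound degenerates only as cos \<theta> tends to 1 or -1; this is the dependence of
  \<open>C\<close> on the eigenvalue. The trees have to stay intact, so switches may exchange
  bipartite edges only. This suffices: the two trees with the root edge form a tree, so every cycle
  contains a bipartite edge. The index j stays free. Neighbouring angles differ by pi/(r+1), and r
  grows both when k grows and when \<epsilon> shrinks, which gives the two density claims.\<close>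

definition biregular :: "nat \<Rightarrow> 'a set \<Rightarrow> 'a set \<Rightarrow> 'a rel \<Rightarrow> bool" where
  "biregular d P M H \<longleftrightarrow> H \<subseteq> P \<times> M \<and>
     (\<forall>u\<in>P. card (H `` {u}) = d) \<and> (\<forall>v\<in>M. card (H\<inverse> `` {v}) = d)"

definition edges :: "'a rel \<Rightarrow> 'a rel \<Rightarrow> 'a rel" where
  "edges T H = T \<union> H \<union> H\<inverse>"

text \<open>
  The edges of \<open>H\<close> on a cycle of length at most \<open>n + 1\<close>: in a power of a reflexive closure
  the exponent only bounds the length of a walk.
\<close>

definition short_edges :: "'a rel \<Rightarrow> 'a rel \<Rightarrow> nat \<Rightarrow> 'a rel" where
  "short_edges T H n =
     {(u, v) \<in> H. (v, u) \<in> ((edges T H - {(u, v), (v, u)})\<^sup>=) ^^ n}"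

section \<open>Walks of bounded length\<close>

lemma relpow_subset: "(R :: 'a rel) \<subseteq> S \<Longrightarrow> R ^^ n \<subseteq> S ^^ n"
  by (induction n) auto

lemma relpow_reflcl_mono:
  assumes "(R :: 'a rel) \<subseteq> S" "m \<le> n" shows "(R\<^sup>=) ^^ m \<subseteq> (S\<^sup>=) ^^ n"
proof -
  have "(R\<^sup>=) ^^ m \<subseteq> (S\<^sup>=) ^^ m"
    using assms(1) by (intro relpow_subset) auto
  also have "\<dots> \<subseteq> (S\<^sup>=) ^^ n"
    using assms(2) by (induction n rule: dec_induct) auto
  finally show ?thesis .
qed

lemma relpow_reflcl_monoD:
  "(x, y) \<in> (R\<^sup>=) ^^ m \<Longrightarrow> R \<subseteq> S \<Longrightarrow> m \<le> n \<Longrightarrow> (x, y) \<in> (S\<^sup>=) ^^ n"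
  using relpow_reflcl_mono by blast

lemma sym_relpow: 
  assumes "sym R" shows "(x, y) \<in> R ^^ n \<Longrightarrow> (y, x) \<in> R ^^ n"
proof (induction n arbitrary: y)
  case (Suc n)
  then obtain z where "(x, z) \<in> R ^^ n" "(z, y) \<in> R" by auto
  then show ?case using Suc.IH assms by (meson relpow_Suc_I2 symD)
qed auto

lemma sym_reflcl_relpow: "sym R \<Longrightarrow> (x, y) \<in> (R\<^sup>=) ^^ n \<Longrightarrow> (y, x) \<in> (R\<^sup>=) ^^ n"
  by (rule sym_relpow) (auto simp: sym_def)

text \<open>
  A walk that uses \<open>N\<close> is cut at its first and last \<open>N\<close>-steps \<open>(x, x')\<close> and \<open>(y', y)\<close>, which may coincide.
\<close>

lemma relpow_Un_first_last:
  assumes "(b, a) \<in> ((F \<union> N)\<^sup>=) ^^ j"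
  shows "(b, a) \<in> (F\<^sup>=) ^^ j \<or>
    (\<exists>x x' y' y i l. (b, x) \<in> (F\<^sup>=) ^^ i \<and> (x, x') \<in> N \<and> (y', y) \<in> N \<and> (y, a) \<in> (F\<^sup>=) ^^ l \<and>
      (x = y' \<and> x' = y \<and> i + l + 1 \<le> j \<or> i + l + 2 \<le> j))"
  using assms
proof (induction j arbitrary: b)
  case (Suc j)
  then obtain c where c: "(b, c) \<in> (F \<union> N)\<^sup>=" "(c, a) \<in> ((F \<union> N)\<^sup>=) ^^ j"
    by (meson relpow_Suc_D2)
  have witness: ?case
    if "(b, x) \<in> (F\<^sup>=) ^^ i" "(x, x') \<in> N" "(y', y) \<in> N" "(y, a) \<in> (F\<^sup>=) ^^ l"
      "x = y' \<and> x' = y \<and> i + l + 1 \<le> Suc j \<or> i + l + 2 \<le> Suc j" for x x' y' y i l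
    using that by blast
  from Suc.IH[OF c(2)] consider
      (short) "(c, a) \<in> (F\<^sup>=) ^^ j"
    | (long) x x' y' y i l where "(c, x) \<in> (F\<^sup>=) ^^ i" "(x, x') \<in> N" "(y', y) \<in> N"
        "(y, a) \<in> (F\<^sup>=) ^^ l" "x = y' \<and> x' = y \<and> i + l + 1 \<le> j \<or> i + l + 2 \<le> j"
    by blast
  then show ?case
  proof cases
    case short
    show ?thesis
    proof (cases "(b, c) \<in> F\<^sup>=")
      case True
      with short show ?thesis by (intro disjI1 relpow_Suc_I2)
    next
      case False
      then have "(b, c) \<in> N" using c(1) by auto
      with short show ?thesis by (intro witness[of b 0 c b c j]) auto
    qed
  next
    case long
    show ?thesis
    proof (cases "(b, c) \<in> F\<^sup>=")
      case True
      then have "(b, x) \<in> (F\<^sup>=) ^^ Suc i" using long(1) by (rule relpow_Suc_I2)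
      moreover have "x = y' \<and> x' = y \<and> Suc i + l + 1 \<le> Suc j \<or> Suc i + l + 2 \<le> Suc j"
        using long(5) by auto
      ultimately show ?thesis using long(2-4) by (intro witness[of x "Suc i" x' y' y l])
    next
      case False
      then have "(b, c) \<in> N" using c(1) by auto
      moreover have "0 + l + 2 \<le> Suc j" using long(5) by auto
      ultimately show ?thesis using long(3,4) by (intro witness[of b 0 c y' y l] disjI2) simp_all
    qed
  qed
qed auto

lemma card_relpow_Image_le:
  fixes R :: "'a rel"
  assumes "\<And>x. finite (R `` {x})" "\<And>x. card (R `` {x}) \<le> D"
  shows "finite ((R ^^ n) `` {x}) \<and> card ((R ^^ n) `` {x}) \<le> D ^ n"
proof (induction n)
  case (Suc n)
  have eq: "(R ^^ Suc n) `` {x} = (\<Union>y\<in>(R ^^ n) `` {x}. R `` {y})" by auto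
  have "card (\<Union>y\<in>(R ^^ n) `` {x}. R `` {y}) \<le> (\<Sum>y\<in>(R ^^ n) `` {x}. card (R `` {y}))"
    using Suc by (intro card_UN_le) auto
  also have "\<dots> \<le> card ((R ^^ n) `` {x}) * D"
    using sum_bounded_above[of "(R ^^ n) `` {x}" "\<lambda>y. card (R `` {y})" D] assms(2) by simp
  also have "\<dots> \<le> D ^ Suc n" using Suc by (simp add: mult.commute)
  finally show ?case unfolding eq using Suc assms(1) by auto
qed auto

text \<open>A walk inside \<open>F\<close> from \<open>v'\<close> to \<open>u\<close> would join the
  two far pairs. Any other walk reaches an end of the second new edge after at most \<open>n\<close>
  steps of \<open>F\<close>: \<open>u'\<close> is excluded by \<open>near\<close>, \<open>v\<close>
  by \<open>far\<close>. Exchanging the roles of the two old edges covers the other new edge of a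
  switch.\<close>

lemma no_short_walk_new_edge:
  assumes "sym F" "m \<le> n + 1"
    and far: "\<And>x y. x \<in> {u, v} \<Longrightarrow> y \<in> {u', v'} \<Longrightarrow> (x, y) \<notin> (F\<^sup>=) ^^ (n + 2)"
    and near: "(v', u') \<notin> (F\<^sup>=) ^^ n"
  shows "(v', u) \<notin> ((F \<union> {(u', v), (v, u')})\<^sup>=) ^^ m"
proof
  have far': "(y, x) \<notin> (F\<^sup>=) ^^ k" if "x \<in> {u, v}" "y \<in> {u', v'}" "k \<le> n + 2" for x y k
    using far[OF that(1,2)] sym_reflcl_relpow[OF \<open>sym F\<close>, of y x k]
      relpow_reflcl_monoD[OF _ order_refl that(3), of x y F] by blast
  assume "(v', u) \<in> ((F \<union> {(u', v), (v, u')})\<^sup>=) ^^ m"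
  from relpow_Un_first_last[OF this] show False
  proof (elim disjE[of "(v', u) \<in> _"] exE conjE)
    assume "(v', u) \<in> (F\<^sup>=) ^^ m"
    then show False using far'[of u v' m] assms(2) by auto
  next
    fix x x' y' y i l
    assume *: "(v', x) \<in> (F\<^sup>=) ^^ i" "(x, x') \<in> {(u', v), (v, u')}"
       "x = y' \<and> x' = y \<and> i + l + 1 \<le> m \<or> i + l + 2 \<le> m"
    then have i: "i \<le> n" using assms(2) by auto
    consider "x = u'" | "x = v" using * by auto
    then show False
    proof cases
      case 1
      then show ?thesis using near relpow_reflcl_monoD[OF *(1) order_refl i] by auto
    next
      case 2
      then show ?thesis using far'[of v v' i] *(1) i by auto
    qed
  qed
qed

lemma sym_edges: "sym T \<Longrightarrow> sym (edges T H)"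
  by (auto simp: edges_def sym_def)

section \<open>Exchanging two bipartite edges\<close>

definition switch :: "'a rel \<Rightarrow> 'a \<Rightarrow> 'a \<Rightarrow> 'a \<Rightarrow> 'a \<Rightarrow> 'a rel" where
  "switch H u v u' v' = H - {(u, v), (u', v')} \<union> {(u, v'), (u', v)}"

text \<open>Every vertex trades one neighbour for another. The two non-edges guarantee that the
  neighbour gained is really new; otherwise a degree would drop.\<close>

lemma biregular_switch:
  assumes "biregular d P M H" "(u, v) \<in> H" "(u', v') \<in> H" "(u, v') \<notin> H" "(u', v) \<notin> H"
    "finite P" "finite M"
  shows "biregular d P M (switch H u v u' v')"
proof -
  have HP: "H \<subseteq> P \<times> M" using assms by (auto simp: biregular_def)
  then have "finite H" using assms finite_subset by blast
  then have fin: "finite (H `` X)" "finite (H\<inverse> `` X)" for X by auto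
  have ne: "u \<noteq> u'" "v \<noteq> v'" using assms by auto
  have card_swap: "card (insert y (A - {x})) = card A" if "finite A" "x \<in> A" "y \<notin> A" for A and x y :: 'a
    using that by (metis Diff_iff card_Suc_Diff1 card_insert_disjoint finite_Diff)
  have "card (switch H u v u' v' `` {a}) = card (H `` {a})" for a
  proof -
    consider "a = u" | "a = u'" | "a \<noteq> u" "a \<noteq> u'" by blast
    then show ?thesis
    proof cases
      case 1
      then have "switch H u v u' v' `` {a} = insert v' (H `` {a} - {v})"
        using ne by (auto simp: switch_def)
      then show ?thesis using card_swap[of "H `` {a}" v v'] fin 1 assms by auto
    next
      case 2
      then have "switch H u v u' v' `` {a} = insert v (H `` {a} - {v'})"
        using ne by (auto simp: switch_def)
      then show ?thesis using card_swap[of "H `` {a}" v' v] fin 2 assms by auto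
    next
      case 3
      then have "switch H u v u' v' `` {a} = H `` {a}" by (auto simp: switch_def)
      then show ?thesis by simp
    qed
  qed
  moreover have "card ((switch H u v u' v')\<inverse> `` {a}) = card (H\<inverse> `` {a})" for a
  proof -
    consider "a = v" | "a = v'" | "a \<noteq> v" "a \<noteq> v'" by blast
    then show ?thesis
    proof cases
      case 1
      then have "(switch H u v u' v')\<inverse> `` {a} = insert u' (H\<inverse> `` {a} - {u})"
        using ne by (auto simp: switch_def)
      then show ?thesis using card_swap[of "H\<inverse> `` {a}" u u'] fin 1 assms by auto
    next
      case 2
      then have "(switch H u v u' v')\<inverse> `` {a} = insert u (H\<inverse> `` {a} - {u'})"
        using ne by (auto simp: switch_def)
      then show ?thesis using card_swap[of "H\<inverse> `` {a}" u' u] fin 2 assms by auto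
    next
      case 3
      then have "(switch H u v u' v')\<inverse> `` {a} = H\<inverse> `` {a}" by (auto simp: switch_def)
      then show ?thesis by simp
    qed
  qed
  moreover have "switch H u v u' v' \<subseteq> P \<times> M" using HP assms by (auto simp: switch_def)
  ultimately show ?thesis using assms(1) by (auto simp: biregular_def)
qed

text \<open>A short cycle through a new edge would leave a short walk of old edges between ends of
  the two removed edges. Ends of different removed edges are more than \<open>n + 2\<close> apart,
  as \<open>n + 4\<close> allows for one step along each of these edges. Ends of the same removed
  edge are more than \<open>n\<close> apart, since otherwise that edge would lie in
  \<open>short_edges T H n\<close>.\<close>

lemma short_edges_switch:
  assumes "sym T" "P \<inter> M = {}" "T \<inter> P \<times> M = {}" "H \<subseteq> P \<times> M"
    and good: "short_edges T H n = {}"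
    and uv: "(u, v) \<in> H" and uv': "(u', v') \<in> H"
    and dist: "(u, u') \<notin> ((edges T H)\<^sup>=) ^^ (n + 4)"
    and m: "m \<le> n + 1"
  shows "short_edges T (switch H u v u' v') m \<subseteq> short_edges T H m - {(u, v)}"
proof -
  define H0 where "H0 = H - {(u, v), (u', v')}"
  define E where "E = edges T H"
  define F where "F = edges T H0"
  define H' where "H' = switch H u v u' v'"
  define N where "N = {(u, v'), (v', u), (u', v), (v, u')}"
  have E': "edges T H' = F \<union> N"
    by (auto simp: edges_def H'_def switch_def F_def N_def H0_def)
  have symE: "sym E" and symF: "sym F"
    using sym_edges assms(1) by (auto simp: E_def F_def)
  have FE: "F \<subseteq> E" by (auto simp: F_def E_def edges_def H0_def)
  have "(x, y) \<notin> F \<and> (y, x) \<notin> F" if "(x, y) \<in> H" "(x, y) \<notin> H0" for x y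
  proof -
    have "(x, y) \<in> P \<times> M" using that(1) assms(4) by blast
    then have "(x, y) \<notin> T" "(y, x) \<notin> H0" "x \<noteq> y"
      using assms(2-4) by (auto simp: H0_def)
    moreover from this have "(y, x) \<notin> T" using symD[OF assms(1)] by blast
    ultimately show ?thesis using that(2) by (simp add: F_def edges_def)
  qed
  then have FE1: "F \<subseteq> E - {(u, v), (v, u)}" "F \<subseteq> E - {(u', v'), (v', u')}"
    using FE uv uv' by (auto simp: H0_def)
  have far: "(x, y) \<notin> (F\<^sup>=) ^^ (n + 2)" if "x \<in> {u, v}" "y \<in> {u', v'}" for x y
  proof
    assume "(x, y) \<in> (F\<^sup>=) ^^ (n + 2)"
    then have "(x, y) \<in> (E\<^sup>=) ^^ (n + 2)" using FE by (rule relpow_reflcl_monoD) simp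
    moreover have "(u, x) \<in> E\<^sup>=" "(y, u') \<in> E\<^sup>="
      using that uv uv' by (auto simp: E_def edges_def)
    ultimately have "(u, u') \<in> (E\<^sup>=) ^^ Suc (Suc (n + 2))"
      by (meson relpow_Suc_I relpow_Suc_I2)
    moreover have "n + 4 = Suc (Suc (n + 2))" by simp
    with dist have "(u, u') \<notin> (E\<^sup>=) ^^ Suc (Suc (n + 2))" by (simp only: E_def not_False_eq_True)
    ultimately show False by contradiction
  qed
  have far': "(y, x) \<notin> (F\<^sup>=) ^^ k \<and> (x, y) \<notin> (F\<^sup>=) ^^ k"
    if "x \<in> {u, v}" "y \<in> {u', v'}" "k \<le> n + 2" for x y k
    using far[OF that(1,2)] sym_reflcl_relpow[OF symF, of y x k]
      relpow_reflcl_monoD[OF _ order_refl that(3), of x y F] by blast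
  have near0: "(v, u) \<notin> (F\<^sup>=) ^^ n" 
    using good uv relpow_reflcl_monoD[OF _ FE1(1) order_refl, of v u n]
    by (auto simp: short_edges_def E_def)
  have near1: "(v', u') \<notin> (F\<^sup>=) ^^ n"
    using good uv' relpow_reflcl_monoD[OF _ FE1(2) order_refl, of v' u' n]
    by (auto simp: short_edges_def E_def)
  \<comment> \<open>All four ends are pairwise more than \<open>n\<close> apart in \<open>F\<close>:
    by \<open>near0\<close> and \<open>near1\<close> along an old edge, by \<open>far'\<close>
    across.\<close>
  have near: "(x, y) \<notin> (F\<^sup>=) ^^ k"
    if "k \<le> n" "x \<in> {u, v, u', v'}" "y \<in> {u, v, u', v'}" "x \<noteq> y" for x y k
  proof
    assume "(x, y) \<in> (F\<^sup>=) ^^ k"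
    then have *: "(x, y) \<in> (F\<^sup>=) ^^ n" by (rule relpow_reflcl_monoD[OF _ subset_refl that(1)])
    then have "(y, x) \<in> (F\<^sup>=) ^^ n" by (rule sym_reflcl_relpow[OF symF])
    with * show False using that near0 near1 far'[of x y n] far'[of y x n] by auto
  qed
  have new1: "(v', u) \<notin> ((edges T H' - {(u, v'), (v', u)})\<^sup>=) ^^ m"
  proof
    assume "(v', u) \<in> ((edges T H' - {(u, v'), (v', u)})\<^sup>=) ^^ m"
    moreover have "edges T H' - {(u, v'), (v', u)} \<subseteq> F \<union> {(u', v), (v, u')}"
      by (auto simp: E' N_def)
    ultimately have "(v', u) \<in> ((F \<union> {(u', v), (v, u')})\<^sup>=) ^^ m"
      by (rule relpow_reflcl_monoD) simp
    then show False using no_short_walk_new_edge[OF symF m far near1] by blast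
  qed
  have new2: "(v, u') \<notin> ((edges T H' - {(u', v), (v, u')})\<^sup>=) ^^ m"
  proof
    assume "(v, u') \<in> ((edges T H' - {(u', v), (v, u')})\<^sup>=) ^^ m"
    moreover have "edges T H' - {(u', v), (v, u')} \<subseteq> F \<union> {(u, v'), (v', u)}"
      by (auto simp: E' N_def)
    ultimately have *: "(v, u') \<in> ((F \<union> {(u, v'), (v', u)})\<^sup>=) ^^ m"
      by (rule relpow_reflcl_monoD) simp
    have "(x, y) \<notin> (F\<^sup>=) ^^ (n + 2)" if "x \<in> {u', v'}" "y \<in> {u, v}" for x y
      using far'[OF that(2,1) order_refl] by blast
    from no_short_walk_new_edge[OF symF m this near0] * show False by blast
  qed
  show ?thesis unfolding H'_def[symmetric]
  proof (rule subrelI)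
    fix a b assume ab: "(a, b) \<in> short_edges T H' m"
    then have walk: "(b, a) \<in> ((edges T H' - {(a, b), (b, a)})\<^sup>=) ^^ m" and "(a, b) \<in> H'"
      by (auto simp: short_edges_def)
    then have abH0: "(a, b) \<in> H0" using new1 new2
      by (auto simp: H'_def switch_def H0_def)
    define F1 where "F1 = F - {(a, b), (b, a)}"
    have F1: "F1 \<subseteq> E - {(a, b), (b, a)}" "F1 \<subseteq> F" using FE by (auto simp: F1_def)
    have abF: "(a, b) \<in> F\<^sup>=" using abH0 by (auto simp: F_def edges_def)
    have "edges T H' - {(a, b), (b, a)} \<subseteq> F1 \<union> N" by (auto simp: E' F1_def)
    then have "(b, a) \<in> ((F1 \<union> N)\<^sup>=) ^^ m"
      by (rule relpow_reflcl_monoD[OF walk]) simp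
    have concl: "(a, b) \<in> short_edges T H m - {(u, v)}" if "(b, a) \<in> (F1\<^sup>=) ^^ k" "k \<le> m" for k
      using relpow_reflcl_monoD[OF that(1) F1(1) that(2)] abH0
      by (auto simp: short_edges_def H0_def E_def)
    \<comment> \<open>The pieces before the first and after the last new step, joined through the
      kept edge from \<open>a\<close> to \<open>b\<close>.\<close>
    have closed: "(y, x) \<in> (F\<^sup>=) ^^ (l + 1 + i)"
      if "(b, x) \<in> (F1\<^sup>=) ^^ i" "(y, a) \<in> (F1\<^sup>=) ^^ l" for x y i l
    proof -
      have "(y, a) \<in> (F\<^sup>=) ^^ l" "(b, x) \<in> (F\<^sup>=) ^^ i"
        by (rule relpow_reflcl_monoD[OF that(2) F1(2) order_refl],
            rule relpow_reflcl_monoD[OF that(1) F1(2) order_refl])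
      moreover have "(a, b) \<in> (F\<^sup>=) ^^ 1" using abF by simp
      ultimately show ?thesis by (meson relpow_trans)
    qed
    from relpow_Un_first_last[OF \<open>(b, a) \<in> ((F1 \<union> N)\<^sup>=) ^^ m\<close>]
    show "(a, b) \<in> short_edges T H m - {(u, v)}"
    proof (elim disjE exE conjE)
      assume "(b, a) \<in> (F1\<^sup>=) ^^ m"
      then show ?thesis using concl by blast
    next
      fix x x' y' y i l
      assume *: "(b, x) \<in> (F1\<^sup>=) ^^ i" "(y, a) \<in> (F1\<^sup>=) ^^ l" "(x, x') \<in> N" "x' = y" "i + l + 1 \<le> m"
      have "(y, x) \<notin> (F\<^sup>=) ^^ (l + 1 + i)"
        using far'[of x y "l + 1 + i"] far'[of y x "l + 1 + i"] * m by (auto simp: N_def)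
      then show ?thesis using closed[OF *(1,2)] by blast
    next
      fix x x' y' y i l
      assume *: "(b, x) \<in> (F1\<^sup>=) ^^ i" "(y, a) \<in> (F1\<^sup>=) ^^ l" "(x, x') \<in> N" "(y', y) \<in> N"
        "i + l + 2 \<le> m"
      show ?thesis
      proof (cases "x = y")
        case True
        then have "(b, a) \<in> (F1\<^sup>=) ^^ (i + l)" using * relpow_trans by metis
        then show ?thesis by (rule concl) (use *(5) in simp)
      next
        case False
        have "(y, x) \<notin> (F\<^sup>=) ^^ (l + 1 + i)"
          using near[of "l + 1 + i" y x] * m False by (auto simp: N_def)
        then show ?thesis using closed[OF *(1,2)] by blast
      qed
    qed
  qed
qed

text \<open>Cycle lengths are cleared one at a time, because a switch is known to be harmless only
  when no shorter cycle is left. Among the graphs cleared up to \<open>n\<close>, one with the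
  fewest short edges for \<open>Suc n\<close> has none: the ball of radius \<open>n + 4\<close>
  around \<open>u\<close> is too small to contain \<open>P\<close>, so a partner edge for an
  improving switch exists. The base \<open>1 + t + d\<close> is the degree bound plus one for the
  reflexive step.\<close>

theorem biregular_long_cycles:
  assumes T: "sym T" "P \<inter> M = {}" "T \<inter> P \<times> M = {}"
    and fin: "finite P" "finite M" "\<And>x. finite (T `` {x})" "\<And>x. card (T `` {x}) \<le> t"
    and H0: "biregular d P M H0" and "d > 0"
    and "(1 + t + d) ^ (n + 3) < card P"
  shows "\<exists>H. biregular d P M H \<and> short_edges T H n = {}"
  using assms(10)
proof (induction n)
  case 0
  \<comment> \<open>The power 0 is the identity, so a short edge would be a loop.\<close>
  have "short_edges T H0 0 = {}" using H0 T by (auto simp: short_edges_def biregular_def)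
  then show ?case using H0 by blast
next
  case (Suc n)
  let ?D = "1 + t + d"
  have "?D ^ (n + 3) \<le> ?D ^ (Suc n + 3)" by (rule power_increasing) auto
  then have ex: "\<exists>H. biregular d P M H \<and> short_edges T H n = {}"
    using Suc.prems by (intro Suc.IH) linarith
  let ?Q = "\<lambda>H. biregular d P M H \<and> short_edges T H n = {}"
  define H where "H = arg_min (\<lambda>H. card (short_edges T H (Suc n))) ?Q"
  have H: "biregular d P M H" "short_edges T H n = {}"
    using arg_min_natI[of ?Q] ex by (auto simp: H_def)
  have min: "card (short_edges T H (Suc n)) \<le> card (short_edges T H' (Suc n))" if "?Q H'" for H'
    using arg_min_nat_le[of ?Q H'] that by (auto simp: H_def)
  have HP: "H \<subseteq> P \<times> M" using H by (auto simp: biregular_def)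
  then have finH: "finite H" using fin finite_subset by blast
  have degree: "finite (((edges T H)\<^sup>=) `` {x}) \<and> card (((edges T H)\<^sup>=) `` {x}) \<le> ?D" for x
  proof -
    have sub: "((edges T H)\<^sup>=) `` {x} = {x} \<union> T `` {x} \<union> (H `` {x} \<union> H\<inverse> `` {x})"
      by (auto simp: edges_def)
    have "card (H `` {x} \<union> H\<inverse> `` {x}) \<le> d"
    proof -
      consider "x \<in> P" | "x \<in> M" | "x \<notin> P" "x \<notin> M" by blast
      then show ?thesis
      proof cases
        case 1
        then have "H\<inverse> `` {x} = {}" using HP T by auto
        then show ?thesis using H(1) 1 by (auto simp: biregular_def)
      next
        case 2
        then have "H `` {x} = {}" using HP T by auto
        then show ?thesis using H(1) 2 by (auto simp: biregular_def)
      next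
        case 3
        then have "H `` {x} \<union> H\<inverse> `` {x} = {}" using HP by auto
        then show ?thesis by (metis card.empty le0)
      qed
    qed
    moreover have "card ({x} \<union> T `` {x}) \<le> 1 + t"
      using card_Un_le[of "{x}" "T `` {x}"] fin(4)[of x] by simp
    ultimately have "card (((edges T H)\<^sup>=) `` {x}) \<le> ?D"
      unfolding sub using card_Un_le[of "{x} \<union> T `` {x}" "H `` {x} \<union> H\<inverse> `` {x}"] by linarith
    moreover have "finite (((edges T H)\<^sup>=) `` {x})"
      unfolding sub using fin finH by auto
    ultimately show ?thesis by blast
  qed
  have "short_edges T H (Suc n) = {}"
  proof (rule ccontr)
    assume "short_edges T H (Suc n) \<noteq> {}"
    then obtain u v where uvs: "(u, v) \<in> short_edges T H (Suc n)" by auto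
    then have uv: "(u, v) \<in> H" by (auto simp: short_edges_def)
    let ?B = "(((edges T H)\<^sup>=) ^^ (n + 4)) `` {u}"
    have B: "finite ?B" "card ?B \<le> ?D ^ (n + 4)"
      using card_relpow_Image_le[of "(edges T H)\<^sup>=" ?D "n + 4" u] degree by blast+
    then have "\<not> P \<subseteq> ?B" using Suc.prems card_mono[OF B(1), of P]
      by (auto simp: eval_nat_numeral)
    then obtain u' where u': "u' \<in> P" "(u, u') \<notin> ((edges T H)\<^sup>=) ^^ (n + 4)" by auto
    have "card (H `` {u'}) > 0" using H u' \<open>d > 0\<close> by (auto simp: biregular_def)
    then obtain v' where uv': "(u', v') \<in> H" by (metis Image_singleton_iff card.empty ex_in_conv less_irrefl)
    have 2: "(u, u') \<notin> ((edges T H)\<^sup>=) ^^ 2"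
      using u'(2) relpow_reflcl_monoD[of u u' 2 "edges T H" "edges T H" "n + 4"] by auto
    have not: "(u, v') \<notin> H" "(u', v) \<notin> H"
      using 2 uv uv' by (auto simp: edges_def numeral_2_eq_2)
    define H' where "H' = switch H u v u' v'"
    have reg: "biregular d P M H'"
      unfolding H'_def using biregular_switch[OF H(1) uv uv' not fin(1,2)] .
    have sub: "short_edges T H' m \<subseteq> short_edges T H m - {(u, v)}" if "m \<le> n + 1" for m
      unfolding H'_def using short_edges_switch[OF T HP H(2) uv uv' u'(2) that] .
    have "short_edges T H' n = {}" using sub[of n] H(2) by auto
    then have "card (short_edges T H (Suc n)) \<le> card (short_edges T H' (Suc n))"
      using min reg by blast
    also have "\<dots> < card (short_edges T H (Suc n))"
    proof (rule psubset_card_mono)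
      show "finite (short_edges T H (Suc n))"
        using finH by (rule finite_subset[rotated]) (auto simp: short_edges_def)
      show "short_edges T H' (Suc n) \<subset> short_edges T H (Suc n)"
        using sub[of "Suc n"] uvs by auto
    qed
    finally show False by simp
  qed
  then show ?case using H by blast
qed

subsection \<open>Closed walks and the girth\<close>

lemma pcas_imp_relpow: "pcas u p v \<Longrightarrow> set p \<subseteq> R \<Longrightarrow> (u, v) \<in> R ^^ length p"
proof (induction p arbitrary: u)
  case (Cons e p)
  then have "(snd e, v) \<in> R ^^ length p" "(u, snd e) \<in> R" by (cases e, auto)+
  then show ?case by (metis length_Cons relpow_Suc_I2)
qed simp

lemma pcas_append: "pcas u (p @ q) w \<longleftrightarrow> (\<exists>v. pcas u p v \<and> pcas v q w)"
  by (induction p arbitrary: u) auto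

lemma pcas_map_fst_snd: "pcas u p v \<Longrightarrow> map fst p @ [v] = u # map snd p"
  by (induction p arbitrary: u) auto

lemma pawalk_verts_pcas: "pcas u p v \<Longrightarrow> pawalk_verts u p = u # map snd p"
  by (induction p arbitrary: u) auto

text \<open>Along a closed walk the list of tails is a rotation of the list of heads.\<close>

lemma closed_pcas_fst:
  assumes "pcas u p u" "distinct (map snd p)"
  shows "set (map fst p) = set (map snd p)" "distinct (map fst p)"
proof -
  have "mset (map fst p @ [u]) = mset (u # map snd p)"
    using pcas_map_fst_snd[OF assms(1)] by presburger
  then have "mset (map fst p) = mset (map snd p)" by simp
  then show "set (map fst p) = set (map snd p)" "distinct (map fst p)"
    using assms(2) by (metis mset_eq_setD, metis mset_eq_imp_distinct_iff)
qed

text \<open>The reverse arc is the delicate point. Tails are distinct, so it could only be the first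
  arc of \<open>q\<close>; by the length bound another arc follows, and \<open>x\<close> would be a
  tail twice.\<close>

lemma closed_pcas_remove_edge:
  assumes cl: "pcas u p u" "distinct (map snd p)" "3 \<le> length p" and xy: "(x, y) \<in> set p"
  obtains q where "pcas y q x" "set p = insert (x, y) (set q)" "(x, y) \<notin> set q" "(y, x) \<notin> set q"
    "Suc (length q) = length p"
proof -
  obtain p1 p2 where p: "p = p1 @ (x, y) # p2" using xy by (meson split_list)
  define q where "q = p2 @ p1"
  have dist: "distinct (map fst p)" using closed_pcas_fst[OF cl(1,2)] by simp
  have q: "pcas y q x" using cl(1) by (auto simp: p q_def pcas_append)
  have len: "Suc (length q) = length p" by (simp add: p q_def)
  have distq: "distinct (map fst q)" "x \<notin> fst ` set q" using dist by (auto simp: p q_def)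
  have "(y, x) \<notin> set q"
  proof
    assume yx: "(y, x) \<in> set q"
    obtain e q' where q': "q = e # q'" using yx by (cases q) auto
    then have "fst e = y" using q by auto
    then have e: "e = (y, x)" using yx distq(1) q' by (force simp: image_iff)
    have "q' \<noteq> []" using len cl(3) q' by auto
    then obtain e' q'' where "q' = e' # q''" by (cases q') auto
    then have "x \<in> fst ` set q" using q q' e by auto
    then show False using distq by simp
  qed
  moreover have "(x, y) \<notin> set q" using distq(2) by (metis fst_conv image_eqI)
  moreover have "set p = insert (x, y) (set q)" by (auto simp: p q_def)
  ultimately show ?thesis using that[OF q] len by blast
qed

text \<open>By \<open>forest\<close> a cycle has an edge in \<open>H\<close>. The rest of the cycle
  is a walk between its ends, and with at most \<open>n\<close> steps it would make the edge short;
  one more edge and a strict bound give \<open>n + 2\<close>.\<close>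

lemma girth_ge:
  assumes pg: "pair_graph G" and parcs: "parcs G = edges T H" and T: "sym T"
    and forest: "\<And>u p. pcas u p u \<Longrightarrow> distinct (map snd p) \<Longrightarrow> 3 \<le> length p \<Longrightarrow> \<not> set p \<subseteq> T"
    and long: "short_edges T H n = {}"
  shows "enat (n + 2) \<le> girth G"
proof -
  interpret pair_graph G by fact
  have "n + 2 \<le> length p" if "cycle p" "3 \<le> length p" for p
  proof (rule ccontr)
    assume "\<not> n + 2 \<le> length p"
    obtain u where u: "awalk u p u" "distinct (tl (pawalk_verts u p))"
      using \<open>cycle p\<close> by (auto simp: cycle_def)
    then have p: "pcas u p u" "set p \<subseteq> edges T H"
      by (auto simp: awalk_def parcs)
    then have dist: "distinct (map snd p)" using u(2) pawalk_verts_pcas[OF p(1)] by simp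
    from forest[OF p(1) dist \<open>3 \<le> length p\<close>] obtain x y where xy: "(x, y) \<in> set p" "(x, y) \<notin> T" by auto
    obtain q where q: "pcas y q x" "set p = insert (x, y) (set q)" "(x, y) \<notin> set q" "(y, x) \<notin> set q"
        "Suc (length q) = length p"
      using closed_pcas_remove_edge[OF p(1) dist \<open>3 \<le> length p\<close> xy(1)] .
    define E where "E = edges T H - {(x, y), (y, x)}"
    have "set q \<subseteq> E\<^sup>=" using q(2-4) p(2) by (auto simp: E_def)
    from pcas_imp_relpow[OF q(1) this] have "(y, x) \<in> (E\<^sup>=) ^^ n"
      using relpow_reflcl_monoD[of y x "length q" E E n] q(5) \<open>\<not> n + 2 \<le> length p\<close> by auto
    moreover have "sym E" using sym_edges[OF T, of H] by (auto simp: E_def sym_def)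
    ultimately have "(x, y) \<in> (E\<^sup>=) ^^ n" "(y, x) \<in> (E\<^sup>=) ^^ n"
      using sym_reflcl_relpow[of E] by blast+
    moreover have "(x, y) \<in> H \<or> (y, x) \<in> H" using xy p(2) by (auto simp: edges_def)
    ultimately show False
    proof (elim disjE)
      assume "(x, y) \<in> H" "(y, x) \<in> (E\<^sup>=) ^^ n"
      then have "(x, y) \<in> short_edges T H n" by (simp add: short_edges_def E_def)
      then show False using long by blast
    next
      assume "(y, x) \<in> H" "(x, y) \<in> (E\<^sup>=) ^^ n"
      moreover have "E = edges T H - {(y, x), (x, y)}" by (auto simp: E_def)
      ultimately have "(y, x) \<in> short_edges T H n" by (simp add: short_edges_def)
      then show False using long by blast
    qed
  qed
  then show ?thesis unfolding girth_def by (intro INF_greatest) auto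
qed

subsection \<open>The double tree\<close>

text \<open>
  Both trees are numbered together in breadth-first order: the roots are \<open>0\<close> and \<open>1\<close>, and the children
  of \<open>x\<close> are \<open>dx + 2, \<dots>, dx + d + 1\<close>. Letting \<open>par\<close> exchange the roots accounts for the edge between them.
\<close>

definition par :: "nat \<Rightarrow> nat \<Rightarrow> nat" where
  "par d x = (if x < 2 then 1 - x else (x - 2) div d)"

function lev :: "nat \<Rightarrow> nat \<Rightarrow> nat" where
  "lev d x = (if x < 2 then 0 else Suc (lev d ((x - 2) div d)))"
  by auto
termination
  by (relation "measure snd") (auto intro: le_less_trans[OF div_le_dividend])

text \<open>The tree containing a vertex, encoded as the sign by which the radial function is
  multiplied; hence a real number.\<close>

function side :: "nat \<Rightarrow> nat \<Rightarrow> real" where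
  "side d x = (if x < 2 then 1 - 2 * real x else side d ((x - 2) div d))"
  by auto
termination
  by (relation "measure snd") (auto intro: le_less_trans[OF div_le_dividend])

declare lev.simps[simp del] side.simps[simp del]

text \<open>The closed form is 2(1 + d + ... + d^i). Breadth-first numbering makes the vertices up
  to a level an initial segment of the naturals, and this is its length.\<close>

primrec tree_size :: "nat \<Rightarrow> nat \<Rightarrow> nat" where
  "tree_size d 0 = 2"
| "tree_size d (Suc i) = d * tree_size d i + 2"

lemma lev_le_iff:
  assumes "d > 0" shows "lev d x \<le> i \<longleftrightarrow> x < tree_size d i"
proof (induction i arbitrary: x)
  case (Suc i)
  show ?case
  proof (cases "x < 2")
    case False
    then have "lev d x \<le> Suc i \<longleftrightarrow> (x - 2) div d < tree_size d i"
      using Suc by (subst lev.simps) simp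
    also have "\<dots> \<longleftrightarrow> x - 2 < tree_size d i * d"
      using assms by (rule div_less_iff_less_mult)
    finally show ?thesis using False by (auto simp: mult.commute)
  qed (simp add: lev.simps)
qed (subst lev.simps, auto)

text \<open>The extra 2 on the left makes the induction close, as 4 is at most 2d.\<close>

lemma tree_size_le:
  assumes "d \<ge> 2" shows "tree_size d i + 2 \<le> 2 * d ^ Suc i"
proof (induction i)
  case (Suc i)
  have "tree_size d (Suc i) + 2 \<le> d * (tree_size d i + 2)"
    using assms by (simp add: algebra_simps)
  also have "\<dots> \<le> d * (2 * d ^ Suc i)" using Suc by (rule mult_le_mono2)
  finally show ?case by (simp add: algebra_simps)
qed (use assms in auto)

lemma tree_size_ge: "d ^ i \<le> tree_size d i"
proof (induction i)
  case (Suc i)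
  then have "d * d ^ i \<le> d * tree_size d i" by (rule mult_le_mono2)
  then show ?case unfolding power_Suc tree_size.simps by linarith
qed simp

lemma side_cases: "side d x = 1 \<or> side d x = -1"
proof (induction x rule: less_induct)
  case (less x)
  show ?case
  proof (cases "x < 2")
    case True
    then show ?thesis by (cases "x = 0") (auto simp: side.simps)
  next
    case False
    then have "(x - 2) div d < x" by (auto intro: le_less_trans[OF div_le_dividend])
    from less[OF this] show ?thesis using False by (subst (1 2) side.simps) simp
  qed
qed

text \<open>The truncated subtraction is right at a root, whose parent is the other root on the same
  level 0.\<close>

lemma lev_par: "lev d (par d x) = lev d x - 1"
  by (cases "x < 2") (auto simp: par_def lev.simps[of d x] lev.simps[of d "Suc 0 - x"])

lemma side_par: "side d (par d x) = (if lev d x = 0 then - side d x else side d x)"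
proof (cases "x < 2")
  case True
  then consider "x = 0" | "x = 1" by linarith
  then show ?thesis by cases (simp_all add: par_def lev.simps side.simps)
qed (simp add: par_def lev.simps[of d x] side.simps[of d x])

lemma lev_0_iff: "lev d x = 0 \<longleftrightarrow> x < 2"
  by (subst lev.simps) simp

section \<open>Children and the sizes of levels\<close>

definition children :: "nat \<Rightarrow> nat \<Rightarrow> nat set" where
  "children d x = {d * x + 2..<d * x + 2 + d}"

lemma mem_children:
  assumes "d > 0" shows "y \<in> children d x \<longleftrightarrow> y \<ge> 2 \<and> par d y = x"
proof -
  have "(y - 2) div d = x \<longleftrightarrow> x * d \<le> y - 2 \<and> y - 2 < Suc x * d"
  proof -
    have "(y - 2) div d = x \<longleftrightarrow> x \<le> (y - 2) div d \<and> (y - 2) div d < Suc x" by auto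
    then show ?thesis
      by (simp only: div_less_iff_less_mult[OF assms] less_eq_div_iff_mult_less_eq[OF assms])
  qed
  moreover have "y \<in> children d x \<longleftrightarrow> y \<ge> 2 \<and> x * d \<le> y - 2 \<and> y - 2 < Suc x * d"
    by (auto simp: children_def mult.commute)
  ultimately show ?thesis by (auto simp: par_def)
qed

lemma children_lev_side:
  assumes "d > 0" "y \<in> children d x"
  shows "lev d y = Suc (lev d x)" "side d y = side d x"
  using assms by (auto simp: mem_children par_def lev.simps[of d y] side.simps[of d y])

lemma card_children [simp]: "card (children d x) = d" "finite (children d x)"
  by (auto simp: children_def)

definition level :: "nat \<Rightarrow> nat \<Rightarrow> real \<Rightarrow> nat set" where
  "level d i s = {x. lev d x = i \<and> side d x = s}"

lemma finite_level [simp]: "d > 0 \<Longrightarrow> finite (level d i s)"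
  by (rule finite_subset[of _ "{..<tree_size d i}"]) (auto simp: level_def simp flip: lev_le_iff)

lemma level_Suc: "d > 0 \<Longrightarrow> level d (Suc i) s = (\<Union>x\<in>level d i s. children d x)"
proof (intro equalityI subsetI)
  fix y assume "d > 0" "y \<in> level d (Suc i) s"
  then show "y \<in> (\<Union>x\<in>level d i s. children d x)"
    using lev_par[of d y] side_par[of d y]
    by (intro UN_I[of "par d y"]) (auto simp: level_def mem_children lev.simps[of d y] split: if_splits)
qed (auto simp: level_def children_lev_side)

lemma card_level:
  assumes "d > 0" "s \<in> {1, -1}" shows "card (level d i s) = d ^ i"
proof (induction i)
  case 0
  have "level d 0 s = {if s = 1 then 0 else 1}"
    using assms(2) by (auto simp: level_def lev_0_iff side.simps less_2_cases_iff)
  then show ?case by simp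
next
  case (Suc i)
  have "card (level d (Suc i) s) = (\<Sum>x\<in>level d i s. card (children d x))"
    unfolding level_Suc[OF assms(1)]
    using assms(1) by (intro card_UN_disjoint) (auto simp: mem_children)
  then show ?case using Suc by simp
qed

lemma sum_tree:
  assumes "d > 0"
  shows "(\<Sum>x<tree_size d m. f (lev d x)) = (\<Sum>i\<le>m. 2 * real d ^ i * f i)"
proof -
  have lev_sum: "(\<Sum>x\<in>{x. lev d x = i}. f (lev d x)) = 2 * real d ^ i * f i" for i
  proof -
    have "{x. lev d x = i} = level d i 1 \<union> level d i (-1)"
      using side_cases by (auto simp: level_def)
    moreover have "(\<Sum>x\<in>level d i 1 \<union> level d i (-1). f (lev d x)) =
      (\<Sum>x\<in>level d i 1. f (lev d x)) + (\<Sum>x\<in>level d i (-1). f (lev d x))"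
      using assms by (intro sum.union_disjoint finite_level) (auto simp: level_def)
    moreover have "(\<Sum>x\<in>level d i s. f (lev d x)) = real (card (level d i s)) * f i" for s
      by (simp add: level_def)
    ultimately show ?thesis using card_level[OF assms] by simp
  qed
  have sum_eq: "(\<Sum>x<tree_size d m. f (lev d x)) = (\<Sum>x\<in>(\<Union>i\<le>m. {x. lev d x = i}). f (lev d x))"
    using lev_le_iff[OF assms] by (intro sum.cong) auto
  also have "\<dots> = (\<Sum>i\<le>m. \<Sum>x\<in>{x. lev d x = i}. f (lev d x))"
  proof (intro sum.UNION_disjoint ballI)
    fix i show "finite {x. lev d x = i}"
      by (rule finite_subset[of _ "{..<tree_size d i}"]) (auto simp flip: lev_le_iff[OF assms])
  qed auto
  also have "\<dots> = (\<Sum>i\<le>m. 2 * real d ^ i * f i)"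
    unfolding lev_sum ..
  finally show ?thesis .
qed

subsection \<open>Double trees with joined leaves\<close>

lemma par_notin_children: "d > 0 \<Longrightarrow> par d x \<notin> children d x"
  using children_lev_side(1)[of d "par d x" x] lev_par[of d x] by auto

lemma par_root: "x < 2 \<Longrightarrow> par d x < 2 \<and> par d (par d x) = x \<and> par d x \<noteq> x"
  by (auto simp: par_def less_2_cases_iff)

lemma par_neq: "d > 0 \<Longrightarrow> par d x \<noteq> x"
  using lev_par[of d x] lev_0_iff[of d x] par_root[of x d] by (cases "x < 2") auto

locale double_tree =
  fixes d r :: nat
  assumes d: "d \<ge> 2" and r: "r \<ge> 1"
begin

definition tree :: "nat rel" where
  "tree = {(x, y). x < tree_size d r \<and> y < tree_size d r \<and> (x = par d y \<or> y = par d x)}"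

lemma d_pos: "d > 0" using d by simp

lemma lt_size: "x < tree_size d r \<longleftrightarrow> lev d x \<le> r"
  using lev_le_iff[OF d_pos] by simp

lemma sym_tree: "sym tree"
  by (auto simp: sym_def tree_def)

lemma tree_Image:
  assumes "x < tree_size d r"
  shows "tree `` {x} = insert (par d x) (if lev d x < r then children d x else {})"
proof (rule Set.set_eqI)
  fix y
  have "par d y = x \<or> y = par d x \<longleftrightarrow> y \<in> children d x \<or> y = par d x"
  proof (cases "y < 2")
    \<comment> \<open>A root is nobody's child, but for a root \<open>y\<close> the two orientations
      \<open>x = par d y\<close> and \<open>y = par d x\<close> agree.\<close>
    case True
    then show ?thesis using par_root[of y d] d_pos by (auto simp: mem_children)
  next
    case False
    then show ?thesis using d_pos by (auto simp: mem_children)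
  qed
  moreover have "y < tree_size d r \<longleftrightarrow> lev d x < r" if "y \<in> children d x"
    using children_lev_side[OF d_pos that] by (auto simp: lt_size)
  moreover have "par d x < tree_size d r"
    using assms lev_par[of d x] by (auto simp: lt_size)
  ultimately show "y \<in> tree `` {x} \<longleftrightarrow>
    y \<in> insert (par d x) (if lev d x < r then children d x else {})"
    using assms by (auto simp: tree_def)
qed

lemma tree_Image_outside: "\<not> x < tree_size d r \<Longrightarrow> tree `` {x} = {}"
  by (auto simp: tree_def)

lemma finite_tree_Image: "finite (tree `` {x})"
  by (cases "x < tree_size d r") (auto simp: tree_Image tree_Image_outside)

lemma card_tree_Image: "card (tree `` {x}) \<le> d + 1"
  by (cases "x < tree_size d r")
    (auto simp: tree_Image tree_Image_outside card_insert_if par_notin_children[OF d_pos])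

abbreviation leaves :: "real \<Rightarrow> nat set" where
  "leaves \<equiv> level d r"

lemma leaves_disjoint: "leaves 1 \<inter> leaves (-1) = {}"
  by (auto simp: level_def)

text \<open>Only the root edge stays within a level, and \<open>r \<ge> 1\<close> keeps the roots
  from being leaves.\<close>

lemma tree_leaves_disjoint: "tree \<inter> leaves s \<times> leaves t = {}"
proof -
  have "lev d x \<noteq> r" if "(x, y) \<in> tree" "lev d y = r" for x y
  proof -
    have "lev d x = lev d y - 1 \<or> lev d y = lev d x - 1"
      using that(1) lev_par by (auto simp: tree_def)
    then show ?thesis using that(2) r by linarith
  qed
  then show ?thesis by (auto simp: level_def)
qed

lemma tree_parent:
  assumes "(x, y) \<in> tree" "lev d y \<le> lev d x" shows "y = par d x"
proof (rule ccontr)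
  assume "y \<noteq> par d x"
  then have x: "x = par d y" using assms(1) by (auto simp: tree_def)
  then have "lev d y = 0" using lev_par[of d y] assms(2) by auto
  then show False using par_root[of y d] \<open>y \<noteq> par d x\<close> x by (simp add: lev_0_iff)
qed

text \<open>At a vertex of maximal level, a cycle would have to enter from and leave to the parent.\<close>

lemma tree_forest:
  assumes cl: "pcas u p u" "distinct (map snd p)" "3 \<le> length p"
  shows "\<not> set p \<subseteq> tree"
proof
  assume sub: "set p \<subseteq> tree"
  let ?V = "set (map fst p)"
  have "finite ?V" "?V \<noteq> {}" using cl(3) by auto
  then have "Max (lev d ` ?V) \<in> lev d ` ?V" by (intro Max_in) auto
  then obtain x where "x \<in> ?V" "Max (lev d ` ?V) = lev d x" by blast
  then have x: "x \<in> ?V" "\<And>y. y \<in> ?V \<Longrightarrow> lev d y \<le> lev d x"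
    using Max_ge[of "lev d ` ?V"] \<open>finite ?V\<close> by (auto simp del: set_map)
  have V: "?V = set (map snd p)" using closed_pcas_fst[OF cl(1,2)] by simp
  obtain b where b: "(x, b) \<in> set p" using x(1) by auto
  obtain a where a: "(a, x) \<in> set p" using x(1) unfolding V by auto
  have "b \<in> ?V" using b unfolding V by force
  then have "b = par d x" using tree_parent[of x b] x(2) b sub by auto
  have "a \<in> ?V" using a by force
  then have "a = par d x" using tree_parent[of x a] x(2) a sub symD[OF sym_tree] by blast
  from closed_pcas_remove_edge[OF cl b] obtain q where
    "set p = insert (x, b) (set q)" "(b, x) \<notin> set q" by blast
  then have "(b, x) = (x, b)" using a \<open>a = par d x\<close> \<open>b = par d x\<close> by blast
  then show False using \<open>b = par d x\<close> par_neq[OF d_pos, of x] by simp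
qed

text \<open>Any starting point for the switching will do. Here it is a disjoint union of complete
  bipartite graphs: \<open>g\<close> matches the parents of the leaves, and the children of matched
  parents are all joined.\<close>

lemma biregular_leaves_ex: "\<exists>H. biregular d (leaves 1) (leaves (-1)) H"
proof -
  obtain r' where r': "r = Suc r'" using r by (cases r) auto
  have "card (level d r' 1) = card (level d r' (-1))" using card_level[OF d_pos] by simp
  then obtain g where g: "bij_betw g (level d r' 1) (level d r' (-1))"
    using finite_same_card_bij[OF finite_level finite_level, OF d_pos d_pos] by blast
  define H where "H = {(x, y) \<in> leaves 1 \<times> leaves (-1). par d y = g (par d x)}"
  have leaf: "x \<in> leaves s \<longleftrightarrow> 2 \<le> x \<and> par d x \<in> level d r' s" for x s
    using d_pos by (auto simp: level_Suc r' mem_children)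
  have "card (H `` {x}) = d" if "x \<in> leaves 1" for x
  proof -
    have "g (par d x) \<in> level d r' (-1)" using that g by (auto simp: leaf bij_betw_def)
    then have "H `` {x} = children d (g (par d x))"
      using that d_pos by (auto simp: H_def mem_children leaf)
    then show ?thesis by simp
  qed
  moreover have "card (H\<inverse> `` {y}) = d" if "y \<in> leaves (-1)" for y
  proof -
    have "par d y \<in> level d r' (-1)" using that by (simp add: leaf)
    then have "par d y \<in> g ` level d r' 1" using bij_betw_imp_surj_on[OF g] by simp
    then obtain z where z: "z \<in> level d r' 1" "par d y = g z" by blast
    have "g z = g w \<longleftrightarrow> w = z" if "w \<in> level d r' 1" for w
      using inj_on_eq_iff[OF bij_betw_imp_inj_on[OF g] z(1) that] by blast
    then have "(x, y) \<in> H \<longleftrightarrow> x \<in> children d z" for x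
      using that z d_pos by (auto simp: H_def mem_children leaf[of x])
    then have "H\<inverse> `` {y} = children d z" by auto
    then show ?thesis by simp
  qed
  ultimately show ?thesis by (intro exI[of _ H]) (auto simp: biregular_def H_def)
qed

text \<open>This is the origin of the factor 1/3 in the girth: the growth rate 2d + 2 is at most d^3
  for every d from 2 on, so balls of radius about r/3 are smaller than the set of d^r leaves on one
  side.\<close>

lemma long_cycles_ex:
  assumes "3 * n + 9 < r"
  shows "\<exists>H. biregular d (leaves 1) (leaves (-1)) H \<and> short_edges tree H n = {}"
proof -
  obtain H0 where H0: "biregular d (leaves 1) (leaves (-1)) H0" using biregular_leaves_ex by blast
  have "1 + (d + 1) + d \<le> 2 * 2 * d" using d by linarith
  also have "\<dots> \<le> d * d * d" using d by (intro mult_mono) auto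
  finally have "(1 + (d + 1) + d) ^ (n + 3) \<le> (d ^ 3) ^ (n + 3)"
    by (intro power_mono) (auto simp: power3_eq_cube)
  also have "\<dots> = d ^ (3 * n + 9)" by (simp flip: power_mult add: algebra_simps)
  also have "\<dots> < d ^ r" using d assms by (intro power_strict_increasing) auto
  also have "\<dots> = card (leaves 1)" using card_level[OF d_pos] by simp
  finally show ?thesis
    by (intro biregular_long_cycles[OF sym_tree leaves_disjoint tree_leaves_disjoint _ _
          finite_tree_Image card_tree_Image H0 d_pos]) (auto simp: d_pos)
qed

section \<open>The regular graph and the eigenvector equation on it\<close>

definition graph_of :: "nat rel \<Rightarrow> nat pair_pre_digraph" where
  "graph_of H = \<lparr>pverts = {0..<tree_size d r}, parcs = edges tree H\<rparr>"

context
  fixes H assumes H: "biregular d (leaves 1) (leaves (-1)) H"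
begin

lemma H_subset: "H \<subseteq> leaves 1 \<times> leaves (-1)"
  using H by (simp add: biregular_def)

lemma edges_subset: "edges tree H \<subseteq> {0..<tree_size d r} \<times> {0..<tree_size d r}"
proof -
  have "leaves s \<subseteq> {0..<tree_size d r}" for s
    by (intro subsetI) (simp add: level_def lt_size)
  then have "H \<subseteq> {0..<tree_size d r} \<times> {0..<tree_size d r}" using H_subset by blast
  moreover have "tree \<subseteq> {0..<tree_size d r} \<times> {0..<tree_size d r}" by (auto simp: tree_def)
  ultimately show ?thesis unfolding edges_def by blast
qed

lemma edges_irrefl: "(x, x) \<notin> edges tree H"
proof -
  have "(x, x) \<notin> H" using H_subset leaves_disjoint by blast
  then show ?thesis using par_neq[OF d_pos, of x] by (simp add: edges_def tree_def)
qed

lemma pair_graph_graph_of: "pair_graph (graph_of H)"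
proof
  fix e assume "e \<in> parcs (graph_of H)"
  then show "fst e \<in> pverts (graph_of H)" "snd e \<in> pverts (graph_of H)" "fst e \<noteq> snd e"
    using edges_subset edges_irrefl by (cases e; force simp: graph_of_def)+
next
  show "finite (parcs (graph_of H))"
    using edges_subset by (auto simp: graph_of_def intro: finite_subset)
  show "symmetric (with_proj (graph_of H))"
    using sym_edges[OF sym_tree, of H] by (simp add: symmetric_def graph_of_def)
qed (simp add: graph_of_def)

lemma edges_Image_inner:
  assumes "lev d x < r" shows "edges tree H `` {x} = insert (par d x) (children d x)"
proof -
  have "edges tree H `` {x} = tree `` {x}"
    using H_subset assms by (auto simp: edges_def level_def)
  then show ?thesis using tree_Image[of x] assms by (simp add: lt_size)
qed

lemma edges_Image_leaf:
  assumes "x \<in> leaves s" "s \<in> {1, -1}"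
  obtains Y where "edges tree H `` {x} = insert (par d x) Y" "Y \<subseteq> leaves (- s)" "card Y = d"
    "par d x \<notin> Y"
proof -
  define Y where "Y = (if s = 1 then H else H\<inverse>) `` {x}"
  have "edges tree H `` {x} = tree `` {x} \<union> Y"
    using H_subset assms by (auto simp: edges_def Y_def level_def)
  also have "tree `` {x} = {par d x}"
    using tree_Image[of x] assms by (simp add: lt_size level_def)
  finally have "edges tree H `` {x} = insert (par d x) Y" by simp
  moreover have "Y \<subseteq> leaves (- s)" "card Y = d"
    using assms H by (auto simp: Y_def biregular_def)
  moreover from this have "par d x \<notin> Y"
    using assms r lev_par[of d x] by (auto simp: level_def)
  ultimately show ?thesis using that by blast
qed

lemma vertex_cases:
  assumes "x < tree_size d r"
  obtains "lev d x < r" | s where "x \<in> leaves s" "s \<in> {1, -1}"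
  using assms side_cases[of d x] by (cases "lev d x = r") (auto simp: lt_size level_def)

lemma regular_graph_of: "regular_graph (graph_of H) (d + 1)"
proof -
  have "card (edges tree H `` {x}) = d + 1" if "x < tree_size d r" for x
    using that
  proof (cases rule: vertex_cases)
    case 1
    then show ?thesis using edges_Image_inner par_notin_children[OF d_pos] by simp
  next
    case (2 s)
    from edges_Image_leaf[OF 2] obtain Y where
      "edges tree H `` {x} = insert (par d x) Y" "card Y = d" "par d x \<notin> Y" by metis
    moreover from this have "finite Y" using d_pos by (intro card_ge_0_finite) simp
    ultimately show ?thesis by simp
  qed
  moreover have "out_degree (with_proj (graph_of H)) x = card (edges tree H `` {x})" for x
  proof -
    have "out_arcs (with_proj (graph_of H)) x = Pair x ` (edges tree H `` {x})"
      by (auto simp: out_arcs_def graph_of_def)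
    then show ?thesis by (simp add: out_degree_def card_image inj_on_def)
  qed
  ultimately show ?thesis
    using pair_graph_graph_of by (simp add: regular_graph_def graph_of_def)
qed

lemma girth_graph_of:
  assumes "short_edges tree H n = {}" shows "enat (n + 2) \<le> girth (graph_of H)"
  using girth_ge[OF pair_graph_graph_of _ sym_tree tree_forest assms]
  by (simp add: graph_of_def)

text \<open>
  The index of \<open>h\<close> is the level plus one, so the first and last hypotheses are the antisymmetric
  boundary conditions across the root edge and across the edges between leaves.
\<close>

lemma sum_neighbours:
  fixes h :: "nat \<Rightarrow> real" and lam :: real
  assumes h: "h 0 = - h 1" "\<And>i. h i + d * h (i + 2) = lam * h (i + 1)" "h (r + 2) = - h (r + 1)"
    and x: "x < tree_size d r"
  defines "w \<equiv> \<lambda>x. side d x * h (lev d x + 1)"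
  shows "(\<Sum>y\<in>edges tree H `` {x}. w y) = lam * w x"
proof -
  have par: "w (par d x) = side d x * h (lev d x)"
    using h(1) lev_par[of d x] side_par[of d x] by (cases "lev d x = 0") (auto simp: w_def)
  show ?thesis using x
  proof (cases rule: vertex_cases)
    case 1
    have "(\<Sum>y\<in>children d x. w y) = (\<Sum>y\<in>children d x. side d x * h (lev d x + 2))"
      using children_lev_side[OF d_pos] by (intro sum.cong) (auto simp: w_def)
    then have "(\<Sum>y\<in>edges tree H `` {x}. w y) = side d x * (h (lev d x) + d * h (lev d x + 2))"
      unfolding edges_Image_inner[OF 1] using par par_notin_children[OF d_pos]
      by (simp add: algebra_simps)
    then show ?thesis using h(2)[of "lev d x"] by (simp add: w_def)
  next
    case (2 s)
    from edges_Image_leaf[OF 2] obtain Y where Y: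
      "edges tree H `` {x} = insert (par d x) Y" "card Y = d" "par d x \<notin> Y" "Y \<subseteq> leaves (- s)" by metis
    moreover from this have "finite Y" using d_pos by (intro card_ge_0_finite) simp
    moreover have "(\<Sum>y\<in>Y. w y) = (\<Sum>y\<in>Y. - s * h (r + 1))"
      using Y(4) by (intro sum.cong) (auto simp: w_def level_def)
    ultimately have "(\<Sum>y\<in>edges tree H `` {x}. w y) = s * (h r + d * h (r + 2))"
      using par 2 h(3) by (simp add: algebra_simps level_def)
    also have "\<dots> = s * (lam * h (r + 1))" using h(2)[of r] by simp
    finally show ?thesis using 2 by (simp add: w_def level_def)
  qed
qed

lemma eigenvector_graph_of:
  assumes "\<And>x. x < tree_size d r \<Longrightarrow> (\<Sum>y\<in>edges tree H `` {x}. w y) = lam * w x"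
    and "\<exists>x<tree_size d r. w x \<noteq> 0"
  shows "eigenvector (adjacency_matrix (graph_of H)) (vec (tree_size d r) w) lam"
proof -
  let ?n = "tree_size d r" and ?A = "adjacency_matrix (graph_of H)"
  have dim: "dim_row ?A = ?n" "dim_col ?A = ?n" by (simp_all add: adjacency_matrix_def graph_of_def)
  have "?A *\<^sub>v vec ?n w = lam \<cdot>\<^sub>v vec ?n w"
  proof (rule eq_vecI)
    fix x assume "x < dim_vec (lam \<cdot>\<^sub>v vec ?n w)"
    then have x: "x < ?n" by simp
    have "(?A *\<^sub>v vec ?n w) $ x = (\<Sum>y\<in>{0..<?n}. (if (x, y) \<in> edges tree H then 1 else 0) * w y)"
      using x by (simp add: dim scalar_prod_def) (simp add: adjacency_matrix_def graph_of_def)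
    also have "\<dots> = (\<Sum>y\<in>edges tree H `` {x}. w y)"
      using edges_subset by (intro sum.mono_neutral_cong_right) auto
    finally show "(?A *\<^sub>v vec ?n w) $ x = (lam \<cdot>\<^sub>v vec ?n w) $ x" using assms(1) x by simp
  qed (simp add: dim)
  moreover have "vec ?n w \<noteq> 0\<^sub>v ?n"
    using assms(2) by (metis index_vec index_zero_vec(1))
  ultimately show ?thesis by (simp add: eigenvector_def dim)
qed

end
end

subsection \<open>Radial eigenvectors\<close>

text \<open>
  The quadratic form below is invariant along the recurrence and comparable to
  \<open>b(i)\<^sup>2 + b(i+1)\<^sup>2\<close>; this is why all levels carry comparable mass.
\<close>

lemma recurrence_energy:
  fixes b :: "nat \<Rightarrow> real"
  assumes rec: "\<And>i. b i + b (i + 2) = 2 * t * b (i + 1)"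
  shows "(b i)\<^sup>2 + (b (i + 1))\<^sup>2 - 2 * t * b i * b (i + 1) =
    (b 0)\<^sup>2 + (b 1)\<^sup>2 - 2 * t * b 0 * b 1"
proof (induction i)
  case (Suc i)
  have *: "b (Suc i + 1) = 2 * t * b (i + 1) - b i" using rec[of i] by simp
  have "(b (Suc i))\<^sup>2 + (b (Suc i + 1))\<^sup>2 - 2 * t * b (Suc i) * b (Suc i + 1) =
    (b i)\<^sup>2 + (b (i + 1))\<^sup>2 - 2 * t * b i * b (i + 1)"
    unfolding * by (simp add: power2_eq_square algebra_simps)
  then show ?case using Suc by simp
qed simp

text \<open>The form has the eigenvalues 1 - t and 1 + t. The smaller one tends to 0 as |t| tends to
  1, which is why the mass constant vanishes at the ends of the spectrum.\<close>

lemma quadratic_form_bounds: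
  fixes x y t :: real
  assumes "\<bar>t\<bar> < 1"
  shows "(1 - \<bar>t\<bar>) * x\<^sup>2 \<le> x\<^sup>2 + y\<^sup>2 - 2 * t * x * y"
    "x\<^sup>2 + y\<^sup>2 - 2 * t * x * y \<le> 2 * (x\<^sup>2 + y\<^sup>2)"
proof -
  have "\<bar>2 * t * x * y\<bar> = \<bar>t\<bar> * (2 * \<bar>x\<bar> * \<bar>y\<bar>)" by (simp add: abs_mult)
  also have "\<dots> \<le> \<bar>t\<bar> * (x\<^sup>2 + y\<^sup>2)"
    using sum_squares_bound[of "\<bar>x\<bar>" "\<bar>y\<bar>"] by (intro mult_left_mono) auto
  finally have *: "\<bar>2 * t * x * y\<bar> \<le> \<bar>t\<bar> * x\<^sup>2 + \<bar>t\<bar> * y\<^sup>2" by (simp add: algebra_simps)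
  have "\<bar>t\<bar> * x\<^sup>2 \<le> 1 * x\<^sup>2" "\<bar>t\<bar> * y\<^sup>2 \<le> 1 * y\<^sup>2"
    using assms by (intro mult_right_mono; simp)+
  with * show "(1 - \<bar>t\<bar>) * x\<^sup>2 \<le> x\<^sup>2 + y\<^sup>2 - 2 * t * x * y"
    "x\<^sup>2 + y\<^sup>2 - 2 * t * x * y \<le> 2 * (x\<^sup>2 + y\<^sup>2)"
    by (auto simp: algebra_simps abs_le_iff)
qed

text \<open>No level exceeds q/(1 - |t|), where q is the invariant. A single level may vanish, so
  the lower bound uses pairs: two consecutive levels carry at least q/2, and m overlapping pairs
  count each level at most twice.\<close>

lemma recurrence_mass:
  fixes b :: "nat \<Rightarrow> real"
  assumes rec: "\<And>i. b i + b (i + 2) = 2 * t * b (i + 1)" and t: "\<bar>t\<bar> < 1"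
  shows "(1 - \<bar>t\<bar>) * real m * (\<Sum>i\<le>r. (b (i + 1))\<^sup>2) \<le> 4 * real (r + 1) * (\<Sum>i\<le>m. (b (i + 1))\<^sup>2)"
proof -
  define q where "q = (b 0)\<^sup>2 + (b 1)\<^sup>2 - 2 * t * b 0 * b 1"
  have up: "(1 - \<bar>t\<bar>) * (b i)\<^sup>2 \<le> q" and low: "q \<le> 2 * ((b i)\<^sup>2 + (b (i + 1))\<^sup>2)" for i
    using quadratic_form_bounds[OF t, of "b i" "b (i + 1)"] recurrence_energy[OF rec, of i]
    by (simp_all add: q_def)
  have "(1 - \<bar>t\<bar>) * (\<Sum>i\<le>r. (b (i + 1))\<^sup>2) \<le> (\<Sum>i\<le>r. q)"
    unfolding sum_distrib_left by (intro sum_mono up)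
  then have "(1 - \<bar>t\<bar>) * (\<Sum>i\<le>r. (b (i + 1))\<^sup>2) \<le> real (r + 1) * q" by simp
  then have 1: "real m * ((1 - \<bar>t\<bar>) * (\<Sum>i\<le>r. (b (i + 1))\<^sup>2)) \<le> real m * (real (r + 1) * q)"
    by (rule mult_left_mono) simp
  have "real m * q = (\<Sum>i<m. q)" by simp
  also have "\<dots> \<le> (\<Sum>i<m. 2 * ((b (i + 1))\<^sup>2 + (b (i + 2))\<^sup>2))"
    using low by (intro sum_mono) (metis add.assoc one_add_one)
  also have "\<dots> = 2 * ((\<Sum>i<m. (b (i + 1))\<^sup>2) + (\<Sum>i<m. (b (Suc i + 1))\<^sup>2))"
    by (simp add: sum_distrib_left sum.distrib)
  also have "\<dots> \<le> 2 * ((\<Sum>i\<le>m. (b (i + 1))\<^sup>2) + (\<Sum>i\<le>m. (b (i + 1))\<^sup>2))"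
  proof -
    have "(\<Sum>i\<le>m. (b (i + 1))\<^sup>2) = (b 1)\<^sup>2 + (\<Sum>i<m. (b (Suc i + 1))\<^sup>2)"
      by (subst sum.atMost_shift) simp
    then have "(\<Sum>i<m. (b (Suc i + 1))\<^sup>2) \<le> (\<Sum>i\<le>m. (b (i + 1))\<^sup>2)" by simp
    moreover have "(\<Sum>i<m. (b (i + 1))\<^sup>2) \<le> (\<Sum>i\<le>m. (b (i + 1))\<^sup>2)"
      by (intro sum_mono2) auto
    ultimately show ?thesis by (intro mult_left_mono add_mono) simp_all
  qed
  finally have "real m * q \<le> 4 * (\<Sum>i\<le>m. (b (i + 1))\<^sup>2)" by simp
  then have "real (r + 1) * (real m * q) \<le> real (r + 1) * (4 * (\<Sum>i\<le>m. (b (i + 1))\<^sup>2))"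
    by (rule mult_left_mono) simp
  with 1 show ?thesis by (simp only: mult_ac)
qed

text \<open>The depth \<open>r\<close> depends only on \<open>d\<close>, \<open>k\<close> and
  \<epsilon>, while \<open>j\<close> ranges over all of 1..r; density is later obtained by choosing
  \<open>j\<close>.\<close>

lemma localized_eigenvalue:
  fixes d k j :: nat and \<epsilon> :: real
  assumes d: "d \<ge> 2" and k: "k \<ge> d ^ 4" and \<epsilon>: "0 < \<epsilon>" "\<epsilon> < 1"
    and j: "1 \<le> j" "j \<le> r" and r_def: "r = nat \<lceil>log (real d) (real k) / \<epsilon>\<rceil> + 10"
  shows "2 * sqrt (real d) * cos (pi * real j / real (r + 1)) \<in>
    localized_eigenvalues d (1 / 3) (\<lambda>lam. (1 - \<bar>lam\<bar> / (2 * sqrt (real d))) / 64) k \<epsilon>"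
proof -
  interpret double_tree d r using d by unfold_locales (auto simp: r_def)
  define \<theta> where "\<theta> = pi * real j / real (r + 1)"
  define t where "t = cos \<theta>"
  define lam where "lam = 2 * sqrt (real d) * t"
  define s where "s = 1 / sqrt (real d)"
  \<comment> \<open>Every combination of sin(i\<theta>) and sin((i-1)\<theta>) solves the
    recurrence. The coefficient \<open>s\<close> is forced by the condition
    \<open>h 0 = - h 1\<close>.\<close>
  define b where "b i = sin (real i * \<theta>) + s * sin ((real i - 1) * \<theta>)" for i :: nat
  define h where "h i = s ^ i * b i" for i \<comment> \<open>the radial function, shifted: \<open>h i = f(i - 1)\<close>\<close>
  define w where "w x = side d x * h (lev d x + 1)" for x
  define l where "l = log (real d) (real k)"
  let ?n = "tree_size d r"
  define W where "W m = (\<Sum>x<tree_size d m. (w x)\<^sup>2)" for m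
  have sd: "sqrt (real d) > 0" and s: "s > 0" "sqrt (real d) * s = 1" "d * s\<^sup>2 = 1"
    using d by (auto simp: s_def power_divide)
  have kpos: "0 < k" using k d by (meson less_le_trans zero_less_numeral zero_less_power)

  \<comment> \<open>The bounds on \<open>j\<close> keep \<theta> away from 0 and pi, where
    \<open>b\<close> would vanish identically and |t| would be 1.\<close>
  have "0 < \<theta>" using j by (simp add: \<theta>_def)
  moreover have "pi * (real j / real (r + 1)) < pi * 1" using j by (intro mult_strict_left_mono) auto
  then have "\<theta> < pi" by (simp add: \<theta>_def)
  ultimately have sin: "sin \<theta> > 0" by (rule sin_gt_zero)
  have "t\<^sup>2 < 1" using sin sin_cos_squared_add[of \<theta>] zero_less_power[OF sin, of 2] unfolding t_def by linarith
  then have t: "\<bar>t\<bar> < 1" by (simp add: abs_square_less_1)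

  have rec: "b i + b (i + 2) = 2 * t * b (i + 1)" for i
  proof -
    have sin_rec: "sin (x - \<theta>) + sin (x + \<theta>) = 2 * t * sin x" for x
      by (simp add: t_def sin_diff sin_add)
    have "sin (real i * \<theta>) + sin (real (i + 2) * \<theta>) = 2 * t * sin (real (i + 1) * \<theta>)"
      using sin_rec[of "real (i + 1) * \<theta>"] by (simp add: algebra_simps)
    moreover have "sin ((real i - 1) * \<theta>) + sin ((real (i + 2) - 1) * \<theta>) =
        2 * t * sin ((real (i + 1) - 1) * \<theta>)"
      using sin_rec[of "real i * \<theta>"] by (simp add: algebra_simps)
    moreover have "x0 + s * y0 + (x2 + s * y2) = 2 * t * (x1 + s * y1)"
      if "x0 + x2 = 2 * t * x1" "y0 + y2 = 2 * t * y1" for x0 x1 x2 y0 y1 y2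
    proof -
      have "s * (y0 + y2) = s * (2 * t * y1)" using that(2) by simp
      then show ?thesis using that(1) by (simp add: algebra_simps)
    qed
    ultimately show ?thesis unfolding b_def by blast
  qed
  have h0: "h 0 = - h 1" by (simp add: h_def b_def)
  have hrec: "h i + d * h (i + 2) = lam * h (i + 1)" for i
  proof -
    have "h i + d * h (i + 2) = s ^ i * (b i + (d * s\<^sup>2) * b (i + 2))"
      by (simp add: h_def algebra_simps power2_eq_square)
    also have "\<dots> = (sqrt (real d) * s) * s ^ i * (2 * t * b (i + 1))"
      using rec[of i] s by simp
    also have "\<dots> = lam * h (i + 1)" by (simp add: h_def lam_def)
    finally show ?thesis .
  qed
  have hr: "h (r + 2) = - h (r + 1)"
  proof -
    have eq: "real (r + 1) * \<theta> = real j * pi" by (simp add: \<theta>_def)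
    have sin0: "sin (real (r + 1) * \<theta>) = 0" unfolding eq by (simp add: sin_npi)
    have "sin (real r * \<theta>) + sin (real (r + 2) * \<theta>) = 2 * t * sin (real (r + 1) * \<theta>)"
      using sin_diff[of "real (r + 1) * \<theta>" \<theta>] sin_add[of "real (r + 1) * \<theta>" \<theta>]
      by (simp add: t_def algebra_simps)
    then have "sin (real (r + 2) * \<theta>) = - sin (real r * \<theta>)" using sin0 by simp
    then have "b (r + 2) = - sin (real r * \<theta>)" "b (r + 1) = s * sin (real r * \<theta>)"
      using sin0 by (simp_all add: b_def algebra_simps)
    then show ?thesis by (simp add: h_def)
  qed
  \<comment> \<open>The d^i vertices of level i on each side cancel the decay of h(i+1)^2, since
    \<open>d * s\<^sup>2 = 1\<close>.\<close>
  have W: "W m = 2 * s\<^sup>2 * (\<Sum>i\<le>m. (b (i + 1))\<^sup>2)" for m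
  proof -
    have "(w x)\<^sup>2 = (h (lev d x + 1))\<^sup>2" for x
      using side_cases[of d x] by (auto simp: w_def power_mult_distrib)
    then have "W m = (\<Sum>i\<le>m. 2 * real d ^ i * (h (i + 1))\<^sup>2)"
      unfolding W_def using sum_tree[OF d_pos, of "\<lambda>i. (h (i + 1))\<^sup>2" m] by simp
    also have "\<dots> = (\<Sum>i\<le>m. 2 * s\<^sup>2 * (b (i + 1))\<^sup>2)"
    proof (intro sum.cong refl)
      fix i
      have "real d ^ i * (h (i + 1))\<^sup>2 = (d * s\<^sup>2) ^ i * s\<^sup>2 * (b (i + 1))\<^sup>2"
        by (simp add: h_def power_mult_distrib power2_eq_square)
      then show "2 * real d ^ i * (h (i + 1))\<^sup>2 = 2 * s\<^sup>2 * (b (i + 1))\<^sup>2"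
        using s by simp
    qed
    finally show ?thesis by (simp add: sum_distrib_left)
  qed

  have l: "real d powr l = real k" using d kpos by (simp add: l_def)
  have "4 = log (real d) (real d powr 4)" using d by simp
  also have "\<dots> = log (real d) (real (d ^ 4))" using d powr_realpow[of d 4] by simp
  also have "\<dots> \<le> l" unfolding l_def using d k kpos by (subst log_le_cancel_iff) auto
  finally have l4: "4 \<le> l" .
  then have le: "l \<le> l / \<epsilon>" using \<epsilon> by (simp add: field_simps)
  \<comment> \<open>Subtracting 2 pays for the bound d^(m+2) on the size of the first levels. The
    threshold d^4 for \<open>k\<close> makes \<open>l\<close> at least 4, just enough for l - 3 to
    be at least l/4.\<close>
  define m where "m = nat \<lfloor>l\<rfloor> - 2"
  have m: "real m \<ge> l / 4" "real (m + 2) \<le> l"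
    using l4 unfolding m_def by linarith+
  have r_bounds: "l / \<epsilon> + 10 \<le> real r" "real (r + 1) \<le> l / \<epsilon> + 12"
    using le l4 unfolding r_def l_def[symmetric] by linarith+

  have "tree_size d m \<le> 2 * d ^ (m + 1)" using tree_size_le[OF d, of m] by simp
  also have "\<dots> \<le> d * d ^ (m + 1)" using d by (rule mult_le_mono1)
  finally have "real (tree_size d m) \<le> real (d ^ (m + 2))" by (subst of_nat_le_iff) simp
  also have "\<dots> = real d powr real (m + 2)" using d by (subst powr_realpow) auto
  also have "\<dots> \<le> real k" using m(2) d unfolding l[symmetric] by (intro powr_mono) auto
  finally have mk: "tree_size d m \<le> k" by simp
  have "real k \<le> real d powr real r" using r_bounds(1) le d unfolding l[symmetric] by (intro powr_mono) auto
  also have "\<dots> = real (d ^ r)" using d by (subst powr_realpow) auto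
  also have "\<dots> \<le> real ?n" using tree_size_ge by simp
  finally have kn: "k \<le> ?n" by simp

  have W_mono: "W i \<le> (\<Sum>x<j. (w x)\<^sup>2)" if "tree_size d i \<le> j" for i j
    unfolding W_def using that by (intro sum_mono2) auto
  have "0 < (b 1)\<^sup>2" using sin by (simp add: b_def)
  also have "\<dots> \<le> (\<Sum>i\<le>r. (b (i + 1))\<^sup>2)"
    by (rule order_trans[OF _ member_le_sum[of 0]]) auto
  finally have Wpos: "W r > 0" unfolding W using s by simp
  \<comment> \<open>The 64 is a product of three factors 4: from \<open>recurrence_mass\<close>,
    from r + 1 being at most 4l/\<epsilon>, and from m being at least l/4.\<close>
  have mass: "(1 - \<bar>t\<bar>) / 64 * \<epsilon> * W r \<le> W m"
  proof -
    have "(1 - \<bar>t\<bar>) * real m * W r = 2 * s\<^sup>2 * ((1 - \<bar>t\<bar>) * real m * (\<Sum>i\<le>r. (b (i + 1))\<^sup>2))"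
      by (simp add: W)
    also have "\<dots> \<le> 2 * s\<^sup>2 * (4 * real (r + 1) * (\<Sum>i\<le>m. (b (i + 1))\<^sup>2))"
      by (intro mult_left_mono recurrence_mass[OF rec t]) auto
    also have "\<dots> = 4 * real (r + 1) * W m" by (simp add: W)
    finally have *: "(1 - \<bar>t\<bar>) * real m * W r \<le> 4 * real (r + 1) * W m" .
    have Wm: "0 \<le> W m" by (simp add: W_def sum_nonneg)
    have "real (r + 1) \<le> 4 * (l / \<epsilon>)" using r_bounds l4 le by linarith
    then have "4 * real (r + 1) * W m \<le> 4 * (4 * (l / \<epsilon>)) * W m"
      using Wm by (intro mult_right_mono mult_left_mono) auto
    moreover have "(1 - \<bar>t\<bar>) * (l / 4) * W r \<le> (1 - \<bar>t\<bar>) * real m * W r"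
      using m(1) t Wpos by (intro mult_right_mono mult_left_mono) auto
    ultimately have "(1 - \<bar>t\<bar>) * (l / 4) * W r \<le> 16 * (l / \<epsilon>) * W m" using * by linarith
    then have "l * ((1 - \<bar>t\<bar>) * \<epsilon> * W r) \<le> l * (64 * W m)"
      using \<epsilon> by (simp add: field_simps)
    then show ?thesis using l4 by simp
  qed

  \<comment> \<open>The summand 10 in \<open>r\<close> absorbs the 9 of
    \<open>long_cycles_ex\<close>, so that the girth bound N + 2 is still at least
    l/(3\<epsilon>).\<close>
  define N where "N = (r - 10) div 3"
  have "3 * N + 9 < r" using r_bounds(1) le l4 unfolding N_def by linarith
  then obtain H where H: "biregular d (leaves 1) (leaves (-1)) H" "short_edges tree H N = {}"
    using long_cycles_ex by blast
  let ?G = "graph_of H"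
  define v where "v = vec ?n (\<lambda>x. w x / sqrt (W r))"
  have pverts: "pverts ?G = {0..<?n}" by (simp add: graph_of_def)
  have "eigenvector (adjacency_matrix ?G) v lam"
    unfolding v_def
  proof (rule eigenvector_graph_of[OF H(1)])
    fix x assume "x < ?n"
    then have "(\<Sum>y\<in>edges tree H `` {x}. w y) = lam * w x"
      unfolding w_def by (intro sum_neighbours[OF H(1) h0 hrec hr])
    then show "(\<Sum>y\<in>edges tree H `` {x}. w y / sqrt (W r)) = lam * (w x / sqrt (W r))"
      by (simp flip: sum_divide_distrib)
  next
    have "w 0 \<noteq> 0" using s sin by (simp add: w_def h_def b_def lev.simps side.simps)
    moreover have "0 < ?n" using kn kpos by simp
    ultimately show "\<exists>x<?n. w x / sqrt (W r) \<noteq> 0" using Wpos by auto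
  qed
  moreover have v: "(\<Sum>x\<in>S. (v $ x)\<^sup>2) = (\<Sum>x\<in>S. (w x)\<^sup>2) / W r" if "S \<subseteq> {0..<?n}" for S
  proof -
    have "(\<Sum>x\<in>S. (v $ x)\<^sup>2) = (\<Sum>x\<in>S. (w x)\<^sup>2 / W r)"
      using that Wpos by (intro sum.cong refl) (auto simp: v_def power_divide)
    then show ?thesis by (simp add: sum_divide_distrib)
  qed
  have "(\<Sum>x\<in>pverts ?G. (v $ x)\<^sup>2) = 1"
    using v[of "{0..<?n}"] Wpos by (simp add: pverts W_def lessThan_atLeast0)
  \<comment> \<open>In breadth-first order the first \<open>k\<close> vertices include all levels up
    to \<open>m\<close>, by \<open>mk\<close>.\<close>
  moreover have "\<exists>S\<subseteq>pverts ?G. card S = k \<and> (\<Sum>x\<in>S. (v $ x)\<^sup>2) \<ge> (1 - \<bar>lam\<bar> / (2 * sqrt (real d))) / 64 * \<epsilon>"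
  proof (intro exI[of _ "{0..<k}"] conjI)
    have "\<bar>lam\<bar> / (2 * sqrt (real d)) = \<bar>t\<bar>" using sd by (simp add: lam_def abs_mult)
    moreover have "(1 - \<bar>t\<bar>) / 64 * \<epsilon> * W r \<le> (\<Sum>x<k. (w x)\<^sup>2)"
      using mass W_mono[OF mk] by (rule order_trans)
    ultimately have "(1 - \<bar>lam\<bar> / (2 * sqrt (real d))) / 64 * \<epsilon> * W r \<le> (\<Sum>x<k. (w x)\<^sup>2)"
      by simp
    then show "(\<Sum>x\<in>{0..<k}. (v $ x)\<^sup>2) \<ge> (1 - \<bar>lam\<bar> / (2 * sqrt (real d))) / 64 * \<epsilon>"
      using v[of "{0..<k}"] kn Wpos by (simp add: pos_le_divide_eq lessThan_atLeast0)
  qed (use kn pverts in auto)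
  moreover have "ereal_of_enat (girth ?G) \<ge> ereal (1 / 3 * (log (real d) (real k) / \<epsilon>))"
  proof -
    have "r \<le> 3 * N + 12" unfolding N_def by linarith
    then have "real r \<le> 3 * real N + 12" by linarith
    then have "l / \<epsilon> \<le> 3 * real (N + 2)" using r_bounds(1) by simp
    then have "ereal (1 / 3 * (l / \<epsilon>)) \<le> ereal_of_enat (enat (N + 2))" by simp
    also have "\<dots> \<le> ereal_of_enat (girth ?G)"
      using girth_graph_of[OF H(1,2)] by (simp only: ereal_of_enat_le_iff)
    finally show ?thesis by (simp add: l_def)
  qed
  moreover have "lam \<in> {- 2 * sqrt (real d) <..< 2 * sqrt (real d)}"
  proof -
    have "\<bar>lam\<bar> < 2 * sqrt (real d) * 1"
      unfolding lam_def abs_mult using t sd by simp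
    then show ?thesis by auto
  qed
  ultimately have "lam \<in> localized_eigenvalues d (1 / 3) (\<lambda>lam. (1 - \<bar>lam\<bar> / (2 * sqrt (real d))) / 64) k \<epsilon>"
    using regular_graph_of[OF H(1)] pverts
    unfolding localized_eigenvalues_def mem_Collect_eq by blast
  then show ?thesis by (simp add: lam_def t_def \<theta>_def)
qed

section \<open>Density of the eigenvalues\<close>

lemma cos_multiples_dense:
  assumes a: "a > 0" and x: "- a < x" "x < a" and e: "e > 0"
  shows "\<exists>R. \<forall>r\<ge>R. \<exists>j\<ge>1. j \<le> r \<and> \<bar>a * cos (pi * real j / real (r + 1)) - x\<bar> < e"
proof -
  define \<phi> where "\<phi> = arccos (x / a)"
  have "-1 < x / a" "x / a < 1" using a x by (auto simp: field_simps)
  then have \<phi>: "0 < \<phi>" "\<phi> < pi" "a * cos \<phi> = x"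
    using arccos_lt_bounded[of "x / a"] a by (auto simp: \<phi>_def)
  have "isCont (\<lambda>y. a * cos y) \<phi>" by (intro continuous_intros)
  then obtain \<delta> where \<delta>: "\<delta> > 0" "\<And>y. \<bar>y - \<phi>\<bar> < \<delta> \<Longrightarrow> \<bar>a * cos y - x\<bar> < e"
    using e \<phi>(3) unfolding continuous_at_eps_delta by (auto simp: dist_real_def)
  \<comment> \<open>A spacing pi/(r+1) below \<delta> puts a multiple close enough to \<phi>; a
    spacing below \<phi> ensures that this multiple is not 0.\<close>
  obtain R :: nat where R: "real R > pi / min \<delta> \<phi>" using reals_Archimedean2 by blast
  have "\<exists>j\<ge>1. j \<le> r \<and> \<bar>a * cos (pi * real j / real (r + 1)) - x\<bar> < e" if "r \<ge> R" for r
  proof -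
    have "pi / min \<delta> \<phi> < real (r + 1)" using R that by linarith
    then have "pi < min \<delta> \<phi> * real (r + 1)"
      using \<delta>(1) \<phi>(1) by (simp add: pos_divide_less_eq mult.commute)
    moreover have "min \<delta> \<phi> * real (r + 1) \<le> \<delta> * real (r + 1)" "min \<delta> \<phi> * real (r + 1) \<le> \<phi> * real (r + 1)"
      by (intro mult_right_mono; simp)+
    ultimately have small: "pi < \<delta> * real (r + 1)" "pi < \<phi> * real (r + 1)" by linarith+
    define z where "z = \<phi> * real (r + 1) / pi"
    define j where "j = nat \<lfloor>z\<rfloor>"
    have "\<phi> * real (r + 1) < pi * real (r + 1)" using \<phi>(2) by (intro mult_strict_right_mono) auto
    then have z: "1 \<le> z" "z < real (r + 1)"
      using small(2) by (simp_all add: z_def pos_divide_less_eq pos_le_divide_eq mult.commute)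
    then have j: "1 \<le> j" "j \<le> r" "real j \<le> z" "z < real j + 1"
      unfolding j_def by linarith+
    have "pi * real j / real (r + 1) \<le> \<phi>"
      using j(3) by (simp add: z_def field_simps)
    moreover have "\<phi> * real (r + 1) < (real j + 1) * pi"
      using j(4) by (simp add: z_def field_simps)
    then have "\<phi> - \<delta> < pi * real j / real (r + 1)"
      using small(1) by (simp add: field_simps)
    ultimately have "\<bar>pi * real j / real (r + 1) - \<phi>\<bar> < \<delta>" by auto
    then show ?thesis using \<delta>(2) j by blast
  qed
  then show ?thesis by blast
qed

theorem theorem1p6:
  shows "\<exists>c::real. c > 0 \<and> (\<forall>d::nat. d \<ge> 2 \<longrightarrow>
    (\<exists>(k0::nat) (C::real \<Rightarrow> real).
      (\<forall>lam\<in>{- 2 * sqrt (real d) <..< 2 * sqrt (real d)}. C lam > 0) \<and>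
      (\<forall>\<^sub>F \<delta> in at_right 0.
         (INF lam\<in>{- 2 * sqrt (real d) + \<delta> .. 2 * sqrt (real d) - \<delta>}. C lam) > 0) \<and>
      (\<forall>k\<ge>k0. \<forall>\<epsilon>\<in>{0<..<1}. localized_eigenvalues d c C k \<epsilon> \<noteq> {}) \<and>
      (\<forall>\<epsilon>\<in>{0<..<1}. {- 2 * sqrt (real d) <..< 2 * sqrt (real d)}
         \<subseteq> closure (\<Union>k\<in>{k0..}. localized_eigenvalues d c C k \<epsilon>)) \<and>
      (\<forall>k\<ge>k0. {- 2 * sqrt (real d) <..< 2 * sqrt (real d)}
         \<subseteq> closure (\<Union>\<epsilon>\<in>{0<..<1}. localized_eigenvalues d c C k \<epsilon>))))"
proof (rule exI[of _ "1 / 3"], intro conjI allI impI)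
  fix d :: nat assume d: "d \<ge> 2"
  define a where "a = 2 * sqrt (real d)"
  have a: "a > 0" using d by (simp add: a_def)
  define C where "C lam = (1 - \<bar>lam\<bar> / a) / 64" for lam
  define \<Lambda> where "\<Lambda> = localized_eigenvalues d (1 / 3) C"
  define r where "r k \<epsilon> = nat \<lceil>log (real d) (real k) / \<epsilon>\<rceil> + 10" for k :: nat and \<epsilon> :: real
  have mem: "a * cos (pi * real j / real (r k \<epsilon> + 1)) \<in> \<Lambda> k \<epsilon>"
    if "k \<ge> d ^ 4" "\<epsilon> \<in> {0<..<1}" "1 \<le> j" "j \<le> r k \<epsilon>" for k j \<epsilon>
    using localized_eigenvalue[OF d that(1) _ _ that(3,4) r_def] that(2)
    by (simp add: \<Lambda>_def a_def C_def[abs_def])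
  \<comment> \<open>The threshold concerns only the quotient log k/\<epsilon>, so one statement
    serves both density claims: it is passed by enlarging \<open>k\<close> for fixed \<epsilon>, or
    by shrinking \<epsilon> for fixed \<open>k\<close>.\<close>
  have near: "\<exists>R. \<forall>k\<ge>d ^ 4. \<forall>\<epsilon>\<in>{0<..<1}. R \<le> log (real d) (real k) / \<epsilon> \<longrightarrow> (\<exists>y\<in>\<Lambda> k \<epsilon>. dist y x < e)"
    if x: "x \<in> {- a<..<a}" and e: "e > 0" for x e
  proof -
    obtain R where R: "\<And>r. r \<ge> R \<Longrightarrow> \<exists>j\<ge>1. j \<le> r \<and> \<bar>a * cos (pi * real j / real (r + 1)) - x\<bar> < e"
      using cos_multiples_dense[OF a _ _ e, of x] x by auto
    show ?thesis
    proof (intro exI[of _ "real R"] allI ballI impI)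
      fix k \<epsilon> assume k: "k \<ge> d ^ 4" and \<epsilon>: "\<epsilon> \<in> {0<..<1}" and "real R \<le> log (real d) (real k) / \<epsilon>"
      then have "R \<le> r k \<epsilon>" unfolding r_def by linarith
      from R[OF this] obtain j where "1 \<le> j" "j \<le> r k \<epsilon>" "\<bar>a * cos (pi * real j / real (r k \<epsilon> + 1)) - x\<bar> < e"
        by blast
      then show "\<exists>y\<in>\<Lambda> k \<epsilon>. dist y x < e" using mem[OF k \<epsilon>] by (metis dist_real_def)
    qed
  qed
  have log_ge: "real M \<le> log (real d) (real k)" if "k \<ge> d ^ M" for k M
  proof -
    have "real d powr real M \<le> real k" using that d by (simp add: powr_realpow)
    moreover have "real k > 0" using that d by (metis gr0I le_zero_eq not_numeral_le_zero of_nat_0_less_iff power_not_zero)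
    ultimately show ?thesis using d by (subst le_log_iff) auto
  qed
  show "\<exists>(k0::nat) (C::real \<Rightarrow> real).
      (\<forall>lam\<in>{- 2 * sqrt (real d) <..< 2 * sqrt (real d)}. C lam > 0) \<and>
      (\<forall>\<^sub>F \<delta> in at_right 0.
         (INF lam\<in>{- 2 * sqrt (real d) + \<delta> .. 2 * sqrt (real d) - \<delta>}. C lam) > 0) \<and>
      (\<forall>k\<ge>k0. \<forall>\<epsilon>\<in>{0<..<1}. localized_eigenvalues d (1/3) C k \<epsilon> \<noteq> {}) \<and>
      (\<forall>\<epsilon>\<in>{0<..<1}. {- 2 * sqrt (real d) <..< 2 * sqrt (real d)}
         \<subseteq> closure (\<Union>k\<in>{k0..}. localized_eigenvalues d (1/3) C k \<epsilon>)) \<and>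
      (\<forall>k\<ge>k0. {- 2 * sqrt (real d) <..< 2 * sqrt (real d)}
         \<subseteq> closure (\<Union>\<epsilon>\<in>{0<..<1}. localized_eigenvalues d (1/3) C k \<epsilon>))"
    unfolding mult_minus_left a_def[symmetric]
  proof (intro exI[of _ "d ^ 4"] exI[of _ C] conjI allI impI ballI subsetI)
    fix lam assume "lam \<in> {- a<..<a}"
    then show "C lam > 0" using a by (auto simp: C_def field_simps abs_if)
  next
    show "\<forall>\<^sub>F \<delta> in at_right 0. (INF lam\<in>{- a + \<delta> .. a - \<delta>}. C lam) > 0"
      unfolding eventually_at_right_field
    proof (intro exI[of _ a] conjI allI impI a)
      fix \<delta> assume \<delta>: "0 < \<delta>" "\<delta> < a"
      \<comment> \<open>With \<delta> below \<open>a\<close> the interval is nonempty, without which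
        the real infimum would say nothing.\<close>
      have "\<delta> / a / 64 \<le> (INF lam\<in>{- a + \<delta> .. a - \<delta>}. C lam)"
      proof (rule cINF_greatest)
        show "{- a + \<delta> .. a - \<delta>} \<noteq> {}" using \<delta> by auto
      next
        fix lam assume "lam \<in> {- a + \<delta> .. a - \<delta>}"
        then have "\<bar>lam\<bar> \<le> a - \<delta>" by auto
        then have "\<delta> / a \<le> 1 - \<bar>lam\<bar> / a" using a by (simp add: field_simps)
        then show "\<delta> / a / 64 \<le> C lam" unfolding C_def by (rule divide_right_mono) simp
      qed
      then show "(INF lam\<in>{- a + \<delta> .. a - \<delta>}. C lam) > 0"
        using \<delta> a by (meson divide_pos_pos less_le_trans zero_less_numeral)
    qed
  next
    fix k \<epsilon> assume "d ^ 4 \<le> k" "\<epsilon> \<in> {0<..<1::real}"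
    then show "localized_eigenvalues d (1/3) C k \<epsilon> \<noteq> {}"
      using mem[of k \<epsilon> 1] by (auto simp: \<Lambda>_def r_def)
  next
    fix \<epsilon> x assume \<epsilon>: "\<epsilon> \<in> {0<..<1::real}" and x: "x \<in> {- a<..<a}"
    show "x \<in> closure (\<Union>k\<in>{d ^ 4..}. localized_eigenvalues d (1/3) C k \<epsilon>)"
      unfolding closure_approachable \<Lambda>_def[symmetric]
    proof (intro allI impI)
      fix e :: real assume "e > 0"
      from near[OF x this] obtain R where
        R: "\<And>k. k \<ge> d ^ 4 \<Longrightarrow> R \<le> log (real d) (real k) / \<epsilon> \<Longrightarrow> \<exists>y\<in>\<Lambda> k \<epsilon>. dist y x < e"
        using \<epsilon> by blast
      obtain M :: nat where M: "real M > R * \<epsilon>" using reals_Archimedean2 by blast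
      let ?k = "max (d ^ 4) (d ^ M)"
      have "R * \<epsilon> \<le> log (real d) (real ?k)" using log_ge[of M ?k] M by simp
      then have "R \<le> log (real d) (real ?k) / \<epsilon>" using \<epsilon> by (simp add: pos_le_divide_eq)
      from R[OF _ this] show "\<exists>y\<in>\<Union>k\<in>{d ^ 4..}. \<Lambda> k \<epsilon>. dist y x < e" by fastforce
    qed
  next
    fix k x assume k: "d ^ 4 \<le> k" and x: "x \<in> {- a<..<a}"
    show "x \<in> closure (\<Union>\<epsilon>\<in>{0<..<1}. localized_eigenvalues d (1/3) C k \<epsilon>)"
      unfolding closure_approachable \<Lambda>_def[symmetric]
    proof (intro allI impI)
      fix e :: real assume "e > 0"
      from near[OF x this] obtain R where
        R: "\<And>\<epsilon>. \<epsilon> \<in> {0<..<1} \<Longrightarrow> R \<le> log (real d) (real k) / \<epsilon> \<Longrightarrow> \<exists>y\<in>\<Lambda> k \<epsilon>. dist y x < e"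
        using k by blast
      \<comment> \<open>This gives R\<epsilon> at most 1, which is below log k; the 2 keeps
        \<epsilon> below 1 even for R = 0.\<close>
      define \<epsilon> where "\<epsilon> = 1 / (\<bar>R\<bar> + 2)"
      have \<epsilon>: "\<epsilon> \<in> {0<..<1}" by (auto simp: \<epsilon>_def)
      have "R * \<epsilon> \<le> 1" by (simp add: \<epsilon>_def field_simps)
      then have "R * \<epsilon> \<le> log (real d) (real k)" using log_ge[OF k] by simp
      then have "R \<le> log (real d) (real k) / \<epsilon>" using \<epsilon> by (simp add: pos_le_divide_eq)
      from R[OF \<epsilon> this] \<epsilon> show "\<exists>y\<in>\<Union>\<epsilon>\<in>{0<..<1}. \<Lambda> k \<epsilon>. dist y x < e" by blast
    qed
  qed
qed simp

end
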